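(* Let $1\to N\to H\to G\to 1$ be an extension of groups such that $N\leq \mathfrak{D}_n(H)$ for a fixed positive integer $n$. Then: (i) if $G$ is finite (or a $p$-group), then $\Gamma_{n+1}(H)$ is finite (or a $p$-group, respectively); (ii) if $G$ is a perfect group, then $\Gamma_{n+1}(H)$ is a perfect group; (iii) if $G$ is polycyclic, then $\Gamma_{n+1}(H)$ is polycyclic.
   Context: An extension of groups $1\to N\to H\to G\to 1$ is a short exact sequence, with $N$ identified with its image in $H$. Commutators are $[g,h]=ghg^{-1}h^{-1}$. For a group $H$, the derived series is indexed by $\Gamma_1(H)=H$ and $\Gamma_{n+1}(H)=[\Gamma_n(H),\Gamma_n(H)]$ for $n\geq 1$. For $n\geq 1$, $\mathfrak{D}_n(H)$ is the group $$\mathfrak{D}_n(H)=\{g\in H \mid [\cdots[[g,x_1],x_2],\cdots,x_n]=1 \text{ for each } x_i\in\Gamma_i(H)\},$$ where $i$ runs over $1,\ldots,n$. Here $p$ is a prime.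
   Formalization: In (i), "p-group" is taken to mean finite p-group, in hypothesis and conclusion; for arbitrary infinite p-groups the claim fails already for n=1, by Adian's torsion-free central extensions of free Burnside groups of large prime exponent. *)

theory Defs
  imports "HOL-Algebra.Exact_Sequence" "HOL-Computational_Algebra.Primes"
begin

text \<open>
  The library predicate \<open>short_exact_sequence\<close> forces the three groups to live on a single type;
  the following is its characterization \<open>short_exact_sequence_iff\<close> for three independent types.
\<close>

definition group_extension ::
  "('a, 'x) monoid_scheme \<Rightarrow> ('b, 'y) monoid_scheme \<Rightarrow> ('c, 'z) monoid_scheme
    \<Rightarrow> ('a \<Rightarrow> 'b) \<Rightarrow> ('b \<Rightarrow> 'c) \<Rightarrow> bool"
  where "group_extension N H G \<iota> \<pi> \<longleftrightarrow>
    group N \<and> group H \<and> group G \<and>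
    \<iota> \<in> mon N H \<and> \<pi> \<in> epi H G \<and> \<iota> ` carrier N = kernel H G \<pi>"

definition commutator :: "('a, 'b) monoid_scheme \<Rightarrow> 'a \<Rightarrow> 'a \<Rightarrow> 'a"
  where "commutator H g h =
    g \<otimes>\<^bsub>H\<^esub> h \<otimes>\<^bsub>H\<^esub> (inv\<^bsub>H\<^esub> g) \<otimes>\<^bsub>H\<^esub> (inv\<^bsub>H\<^esub> h)"

text \<open>
  The derived series is indexed from \<open>1\<close>: \<open>derived_series H 1\<close> is the whole group. The value
  at \<open>0\<close> is junk. The library constant \<^const>\<open>derived\<close> uses the same commutator
  convention as \<^const>\<open>commutator\<close>.
\<close>

definition derived_series :: "('a, 'b) monoid_scheme \<Rightarrow> nat \<Rightarrow> 'a set"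
  where "derived_series H n = (derived H ^^ (n - 1)) (carrier H)"

text \<open>\<open>left_commutator H g x n\<close> is \<open>[...[[g, x 1], x 2], ..., x n]\<close>.\<close>

primrec left_commutator :: "('a, 'b) monoid_scheme \<Rightarrow> 'a \<Rightarrow> (nat \<Rightarrow> 'a) \<Rightarrow> nat \<Rightarrow> 'a"
  where
    "left_commutator H g x 0 = g"
  | "left_commutator H g x (Suc n) = commutator H (left_commutator H g x n) (x (Suc n))"

definition derived_centre :: "nat \<Rightarrow> ('a, 'b) monoid_scheme \<Rightarrow> 'a set"
  where "derived_centre n H =
    {g \<in> carrier H. \<forall>x. (\<forall>i\<in>{1..n}. x i \<in> derived_series H i) \<longrightarrow>
       left_commutator H g x n = \<one>\<^bsub>H\<^esub>}"

text \<open>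
  Here \<open>p\<close>-groups are finite. For infinite groups whose elements merely have \<open>p\<close>-power order,
  already the case \<open>N \<le> Z(H)\<close> fails: for large primes \<open>p\<close>, Adian constructed nonabelian
  torsion-free central extensions of the infinite free Burnside groups of exponent \<open>p\<close>.
  Since \<^const>\<open>order\<close> is \<open>0\<close> on infinite groups, the equation below includes finiteness.
\<close>

definition finite_p_group :: "nat \<Rightarrow> ('a, 'b) monoid_scheme \<Rightarrow> bool"
  where "finite_p_group p G \<longleftrightarrow> group G \<and> (\<exists>k. order G = p ^ k)"

definition perfect_group :: "('a, 'b) monoid_scheme \<Rightarrow> bool"
  where "perfect_group G \<longleftrightarrow> group G \<and> derived G (carrier G) = carrier G"

text \<open>
  \<open>polycyclic_seq G K\<close>: there is a finite subnormal series from the trivial subgroup up to \<open>K\<close>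
  with cyclic factors (compare \<^const>\<open>solvable_seq\<close>).
\<close>

inductive polycyclic_seq :: "('a, 'b) monoid_scheme \<Rightarrow> 'a set \<Rightarrow> bool"
  for G where
    unity: "polycyclic_seq G {\<one>\<^bsub>G\<^esub>}"
  | extension: "\<lbrakk> polycyclic_seq G K; K \<lhd> (G\<lparr>carrier := L\<rparr>); subgroup L G;
                  cyclic_group ((G\<lparr>carrier := L\<rparr>) Mod K) \<rbrakk> \<Longrightarrow> polycyclic_seq G L"

definition polycyclic :: "('a, 'b) monoid_scheme \<Rightarrow> bool"
  where "polycyclic G \<longleftrightarrow> group G \<and> polycyclic_seq G (carrier G)"

end

theory Submission
  imports Defs "HOL-Algebra.Sylow" "HOL-Algebra.Multiplicative_Group"
begin

text \<open>
  Put \<open>E\<^sub>n\<^sub>+\<^sub>1 = 1\<close> and let \<open>E\<^sub>i\<close> be the set of all \<open>g\<close> with \<open>[g, \<Gamma>\<^sub>i(H)] \<subseteq> E\<^sub>i\<^sub>+\<^sub>1\<close>. These are normal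
  subgroups, and \<open>N \<subseteq> E\<^sub>1\<close>, so that \<open>H / E\<^sub>1\<close> is a quotient of \<open>G\<close>. The image of \<open>\<Gamma>\<^sub>i(H)\<close> in
  \<open>H / E\<^sub>i\<^sub>+\<^sub>1\<close> is a central extension of its image in \<open>H / E\<^sub>i\<close>. Hence it suffices that each of the
  four properties passes to epimorphic images, and passes from \<open>Q / Z\<close> to \<open>[Q, Q]\<close> whenever \<open>Z\<close> is
  central in \<open>Q\<close>.

  For finite groups the latter is Schur's theorem, which follows from the transfer into \<open>Z\<close>.
  If \<open>Q / Z\<close> is perfect, then \<open>Q = [Q, Q] Z\<close> and therefore \<open>[Q, Q] = [[Q, Q], [Q, Q]]\<close>.
  If \<open>Q / Z\<close> is polycyclic, then there is a polycyclic \<open>P \<le> Q\<close> with \<open>Q = P Z\<close>, whence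
  \<open>[Q, Q] = [P, P]\<close> is polycyclic.
\<close>

subsection \<open>Central extensions of finite and of perfect groups\<close>

text \<open>A new generator \<open>a\<close> of finite order enlarges the generated subgroup at most
  to its product with a finite cyclic group.\<close>

lemma (in comm_group) finite_generate:
  assumes "finite F" and "F \<subseteq> carrier G"
    and "\<And>x. x \<in> F \<Longrightarrow> x [^] (m::nat) = \<one>" and "m > 0"
  shows "finite (generate G F)"
  using assms(1-3)
proof (induction F rule: finite_induct)
  case empty
  then show ?case by (simp add: generate_empty)
next
  case (insert a F)
  have sub: "subgroup (generate G {a}) G" "subgroup (generate G F) G"
    using insert.prems by (auto intro!: generate_is_subgroup)
  have "ord a \<noteq> 0"
    using insert.prems \<open>m > 0\<close> ord_eq_0 by blast
  then have "finite (generate G {a})"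
    using finite_cyclic_subgroup_order[of a] insert.prems
    by (simp add: carrier_subgroup_generated)
  moreover have "finite (generate G F)"
    using insert by auto
  ultimately have fin: "finite (generate G {a} <#> generate G F)"
    by (auto simp: set_mult_def)
  have "a \<in> generate G {a} <#> generate G F"
    using insert.prems generate.one[of G F] generate.incl[of a "{a}" G]
    unfolding set_mult_def by force
  moreover have "x \<in> generate G {a} <#> generate G F" if "x \<in> F" for x
    using that insert.prems generate.one[of G "{a}"] generate.incl[of x F G]
    unfolding set_mult_def by force
  ultimately have "generate G (insert a F) \<subseteq> generate G {a} <#> generate G F"
    by (intro generate_subgroup_incl mult_subgroups[OF sub]) auto
  then show ?case
    using fin finite_subset by blast
qed

text \<open>Cauchy's theorem: a prime \<open>q\<close> dividing the order gives a subgroup of order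
  \<open>q\<close>, hence an element of order \<open>q\<close>. So \<open>q\<close> divides
  \<open>p ^ k\<close> and equals \<open>p\<close>.\<close>

lemma (in group) order_prime_power:
  fixes p :: nat
  assumes "finite (carrier G)" and "Factorial_Ring.prime p"
    and exponent: "\<And>x. x \<in> carrier G \<Longrightarrow> x [^] (p ^ k) = \<one>"
  shows "\<exists>l. order G = p ^ l"
proof -
  have q: "q = p" if q: "Factorial_Ring.prime q" "q dvd order G" for q
  proof -
    obtain c where "order G = q * c"
      using q(2) by (rule dvdE)
    then obtain S where S: "subgroup S G" "card S = q"
      using sylow_thm[of q G 1 c] q assms(1) is_group by auto
    then have "S \<noteq> {\<one>}"
      using q(1) S(2) by auto
    then obtain x where x: "x \<in> S" "x \<noteq> \<one>"
      using subgroup.one_closed[OF S(1)] by blast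
    interpret S: group "G\<lparr>carrier := S\<rparr>"
      by (rule subgroup_imp_group[OF S(1)])
    have xG: "x \<in> carrier G" by (rule subgroup.mem_carrier[OF S(1) x(1)])
    have "x [^] q = \<one>"
      using S.pow_order_eq_1[of x] x(1) S(2) nat_pow_consistent[of x q S] by (simp add: order_def)
    then have "ord x dvd q" by (simp add: pow_eq_id xG)
    moreover have "ord x \<noteq> 1" using x xG ord_eq_1 by blast
    ultimately have "ord x = q" using q(1) unfolding prime_nat_iff by blast
    moreover have "ord x dvd p ^ k" using exponent[OF xG] by (simp add: pow_eq_id xG)
    ultimately show "q = p"
      using q(1) assms(2) prime_dvd_power primes_dvd_imp_eq by blast
  qed
  have "order G \<noteq> 0" using assms(1) order_gt_0_iff_finite by auto
  then obtain l c where lc: "order G = p ^ l * c" "\<not> p dvd c"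
    using multiplicity_decompose'[of "order G" p] not_prime_unit[of p] assms(2) by blast
  have "c = 1"
  proof (rule ccontr)
    assume "c \<noteq> 1"
    then obtain q where "Factorial_Ring.prime q" "q dvd c" using prime_factor_nat by blast
    then show False using q[of q] lc by auto
  qed
  then show ?thesis using lc by auto
qed

section \<open>Central extensions and their commutators\<close>

text \<open>An epimorphism \<open>h\<close> stands for the quotient map, so that extension and
  quotient may have different types. The names come from \<open>group_hom\<close>: \<open>G\<close>
  is the extension (the Q of the overview), \<open>H\<close> its quotient, and the kernel is
  Z.\<close>

locale central_extension = group_hom +
  assumes surj: "h ` carrier G = carrier H"
    and central: "\<lbrakk>z \<in> kernel G H h; x \<in> carrier G\<rbrakk> \<Longrightarrow> z \<otimes> x = x \<otimes> z"
begin

lemma kernel_quotient: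
  assumes "x \<in> carrier G" "y \<in> carrier G" "h x = h y"
  shows "x \<otimes> inv y \<in> kernel G H h" "inv y \<otimes> x \<in> kernel G H h"
  using assms by (auto simp: kernel_def)

text \<open>Elements with equal images differ by a central factor and therefore conjugate alike.
  Bracketing a commutator in two ways shows \<open>x\<close> and then \<open>y\<close> acting by
  conjugation alone.\<close>

lemma commutator_cong:
  assumes "x \<in> carrier G" "x' \<in> carrier G" "y \<in> carrier G" "y' \<in> carrier G"
    and "h x = h x'" "h y = h y'"
  shows "x \<otimes> y \<otimes> inv x \<otimes> inv y = x' \<otimes> y' \<otimes> inv x' \<otimes> inv y'"
proof -
  have *: "(a \<otimes> z) \<otimes> b \<otimes> inv (a \<otimes> z) = a \<otimes> b \<otimes> inv a"
    if "z \<in> kernel G H h" "a \<in> carrier G" "b \<in> carrier G" for z a b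
  proof -
    have z: "z \<in> carrier G" using that by (simp add: kernel_def)
    have "(a \<otimes> z) \<otimes> b \<otimes> inv (a \<otimes> z) = a \<otimes> (z \<otimes> b) \<otimes> inv z \<otimes> inv a"
      using that z by (simp add: G.m_assoc G.inv_mult_group)
    also have "\<dots> = a \<otimes> b \<otimes> inv a"
      using that z by (simp add: central G.m_assoc)
    finally show ?thesis .
  qed
  have "x = x' \<otimes> (inv x' \<otimes> x)" "y = y' \<otimes> (inv y' \<otimes> y)"
    using assms by (simp_all flip: G.m_assoc)
  then have conj: "x \<otimes> b \<otimes> inv x = x' \<otimes> b \<otimes> inv x'" "y \<otimes> b \<otimes> inv y = y' \<otimes> b \<otimes> inv y'"
    if "b \<in> carrier G" for b
    using *[of "inv x' \<otimes> x" x' b] *[of "inv y' \<otimes> y" y' b] that kernel_quotient assms by auto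
  have "x \<otimes> y \<otimes> inv x \<otimes> inv y = x' \<otimes> (y \<otimes> inv x' \<otimes> inv y)"
    using assms conj(1)[of y] by (simp add: G.m_assoc)
  also have "\<dots> = x' \<otimes> y' \<otimes> inv x' \<otimes> inv y'"
    using assms conj(2)[of "inv x'"] by (simp add: G.m_assoc)
  finally show ?thesis .
qed

text \<open>Any two elements can be replaced by elements of \<open>P\<close> with the same images,
  which leaves their commutator unchanged.\<close>

lemma derived_eq:
  assumes "subgroup P G" and "h ` P = carrier H"
  shows "derived G (carrier G) = derived G P"
proof
  have "derived_set G (carrier G) \<subseteq> derived_set G P"
  proof
    fix c assume "c \<in> derived_set G (carrier G)"
    then obtain x y where xy: "x \<in> carrier G" "y \<in> carrier G" "c = x \<otimes> y \<otimes> inv x \<otimes> inv y"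
      by auto
    then have "h x \<in> h ` P" "h y \<in> h ` P" using assms(2) by auto
    then obtain x' y' where "x' \<in> P" "y' \<in> P" "h x = h x'" "h y = h y'"
      by (auto simp: image_iff)
    then show "c \<in> derived_set G P"
      using commutator_cong[of x x' y y'] xy subgroup.mem_carrier[OF assms(1)] by auto
  qed
  then show "derived G (carrier G) \<subseteq> derived G P"
    unfolding derived_def by (rule G.mono_generate)
  show "derived G P \<subseteq> derived G (carrier G)"
    using assms(1) subgroup.subset by (intro G.mono_derived) blast
qed

lemma subgroup_derived: "subgroup (derived G (carrier G)) G"
  by (simp add: G.derived_is_subgroup)

text \<open>The derived subgroup maps onto a perfect quotient, so it can itself serve as
  \<open>P\<close> in \<open>derived_eq\<close>.\<close>

lemma perfect_derived:
  assumes "perfect_group H"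
  shows "perfect_group (G\<lparr>carrier := derived G (carrier G)\<rparr>)"
proof -
  have "h ` derived G (carrier G) = carrier H"
    using assms derived_img[of "carrier G"] by (simp add: surj perfect_group_def)
  then have "derived G (carrier G) = derived G (derived G (carrier G))"
    using derived_eq subgroup_derived by blast
  then show ?thesis
    by (simp add: perfect_group_def G.derived_consistent subgroup_derived G.subgroup_imp_group)
qed

section \<open>Schur's theorem via the transfer\<close>

lemma comm_group_kernel: "comm_group (G\<lparr>carrier := kernel G H h\<rparr>)"
proof -
  interpret K: group "G\<lparr>carrier := kernel G H h\<rparr>"
    by (simp add: G.subgroup_imp_group subgroup_kernel)
  show ?thesis
    by (rule K.group_comm_groupI) (auto simp: central kernel_def)
qed

text \<open>The transfer \<open>G \<rightarrow> Z\<close> into a central subgroup \<open>Z\<close> of index \<open>m\<close> is \<open>z \<mapsto> z\<^sup>m\<close>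
  on \<open>Z\<close> and, as \<open>Z\<close> is abelian, trivial on the derived subgroup.\<close>

lemma kernel_derived_exponent:
  assumes "finite (carrier H)" and "z \<in> kernel G H h" and "z \<in> derived G (carrier G)"
  shows "z [^] order H = \<one>"
proof -
  let ?K = "G\<lparr>carrier := kernel G H h\<rparr>"
  interpret K: comm_group ?K by (rule comm_group_kernel)
  define t where "t = inv_into (carrier G) h"
  have t: "t r \<in> carrier G" "h (t r) = r" if "r \<in> carrier H" for r
    using that surj unfolding t_def by (auto intro: inv_into_into f_inv_into_f)
  \<comment> \<open>Left multiplication by \<open>g\<close> carries the representative
    \<open>t r\<close> to the representative of another coset times the kernel element
    \<open>c g r\<close>. The transfer \<open>\<tau> g\<close> is the product of these
    factors.\<close>
  define c where "c g r = inv (t (h g \<otimes>\<^bsub>H\<^esub> r)) \<otimes> (g \<otimes> t r)" for g r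
  have c: "c g r \<in> kernel G H h" if "g \<in> carrier G" "r \<in> carrier H" for g r
    using that t by (auto simp: c_def kernel_def)
  define \<tau> where "\<tau> g = finprod ?K (c g) (carrier H)" for g
  have \<tau>: "\<tau> g \<in> kernel G H h" if "g \<in> carrier G" for g
    using K.finprod_closed[of "c g" "carrier H"] that c by (auto simp: \<tau>_def)
  have mult: "\<tau> (a \<otimes> b) = \<tau> a \<otimes> \<tau> b" if ab: "a \<in> carrier G" "b \<in> carrier G" for a b
  proof -
    \<comment> \<open>The cocycle identity. Multiplication by \<open>h b\<close> only permutes the
      index set of the product, which makes \<open>\<tau>\<close> multiplicative.\<close>
    have cc: "c (a \<otimes> b) r = c a (h b \<otimes>\<^bsub>H\<^esub> r) \<otimes> c b r" if "r \<in> carrier H" for r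
    proof -
      let ?u = "t (h a \<otimes>\<^bsub>H\<^esub> (h b \<otimes>\<^bsub>H\<^esub> r))" and ?v = "t (h b \<otimes>\<^bsub>H\<^esub> r)"
      have v: "?v \<otimes> (inv ?v \<otimes> (b \<otimes> t r)) = b \<otimes> t r"
        using ab that t by (simp flip: G.m_assoc)
      have "c a (h b \<otimes>\<^bsub>H\<^esub> r) \<otimes> c b r = inv ?u \<otimes> (a \<otimes> (?v \<otimes> (inv ?v \<otimes> (b \<otimes> t r))))"
        unfolding c_def using ab that t by (simp add: G.m_assoc)
      also have "\<dots> = c (a \<otimes> b) r"
        unfolding c_def v using ab that t by (simp add: G.m_assoc H.m_assoc)
      finally show ?thesis by simp
    qed
    have img: "(\<lambda>r. h b \<otimes>\<^bsub>H\<^esub> r) ` carrier H = carrier H"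
      using ab H.surj_const_mult by simp
    have inj: "inj_on (\<lambda>r. h b \<otimes>\<^bsub>H\<^esub> r) (carrier H)"
      using ab H.inj_on_cmult by simp
    have "\<tau> (a \<otimes> b) = finprod ?K (\<lambda>r. c a (h b \<otimes>\<^bsub>H\<^esub> r) \<otimes>\<^bsub>?K\<^esub> c b r) (carrier H)"
      unfolding \<tau>_def using ab c[of a] c[of b]
      by (intro K.finprod_cong') (auto simp: cc intro!: subgroup.m_closed[OF subgroup_kernel])
    also have "\<dots> = finprod ?K (\<lambda>r. c a (h b \<otimes>\<^bsub>H\<^esub> r)) (carrier H) \<otimes>\<^bsub>?K\<^esub> \<tau> b"
      unfolding \<tau>_def using ab c by (intro K.finprod_multf) auto
    also have "finprod ?K (\<lambda>r. c a (h b \<otimes>\<^bsub>H\<^esub> r)) (carrier H) = \<tau> a"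
      unfolding \<tau>_def using K.finprod_reindex[OF _ inj, of "c a"] ab c img by auto
    finally show ?thesis by simp
  qed
  interpret \<tau>: group_hom G ?K \<tau>
    by unfold_locales (auto simp: hom_def \<tau> mult)
  have "\<tau> ` derived G (carrier G) = derived ?K (\<tau> ` carrier G)"
    using \<tau>.derived_img[of "carrier G"] by simp
  also have "\<dots> \<subseteq> {\<one>}"
    using K.derived_eq_singleton[of "\<tau> ` carrier G"] \<tau> by auto
  finally have "\<tau> z = \<one>" using assms(3) by auto
  moreover have "\<tau> z = z [^] order H"
  proof -
    have z: "z \<in> carrier G" "h z = \<one>\<^bsub>H\<^esub>" using assms(2) by (auto simp: kernel_def)
    \<comment> \<open>A kernel element fixes every index, and centrality moves it past
      \<open>t r\<close>.\<close>
    have "c z r = z" if "r \<in> carrier H" for r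
    proof -
      have "c z r = inv (t r) \<otimes> (t r \<otimes> z)"
        using z that t central[OF assms(2), of "t r"] by (simp add: c_def)
      also have "\<dots> = z" using z that t by (simp flip: G.m_assoc)
      finally show ?thesis .
    qed
    then have "\<tau> z = finprod ?K (\<lambda>_. z) (carrier H)"
      unfolding \<tau>_def using assms(2) by (intro K.finprod_cong') auto
    also have "\<dots> = z [^] order H"
      using K.finprod_const[of z "carrier H"] assms(2)
      by (simp add: order_def flip: G.nat_pow_consistent)
    finally show ?thesis .
  qed
  ultimately show ?thesis by simp
qed

text \<open>A commutator depends only on the images of its two entries, so there are no more
  commutators than pairs in \<open>H\<close>.\<close>

lemma finite_derived_set:
  assumes "finite (carrier H)"
  shows "finite (derived_set G (carrier G))"
proof -
  define t where "t = inv_into (carrier G) h"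
  have t: "t r \<in> carrier G" "h (t r) = r" if "r \<in> carrier H" for r
    using that surj unfolding t_def by (auto intro: inv_into_into f_inv_into_f)
  have "derived_set G (carrier G) \<subseteq>
      (\<lambda>(r, s). t r \<otimes> t s \<otimes> inv (t r) \<otimes> inv (t s)) ` (carrier H \<times> carrier H)"
  proof
    fix c assume "c \<in> derived_set G (carrier G)"
    then obtain x y where xy: "x \<in> carrier G" "y \<in> carrier G" "c = x \<otimes> y \<otimes> inv x \<otimes> inv y"
      by auto
    then have "c = t (h x) \<otimes> t (h y) \<otimes> inv (t (h x)) \<otimes> inv (t (h y))"
      using commutator_cong[of x "t (h x)" y "t (h y)"] t by auto
    then show "c \<in> (\<lambda>(r, s). t r \<otimes> t s \<otimes> inv (t r) \<otimes> inv (t s)) ` (carrier H \<times> carrier H)"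
      using xy by (auto intro!: image_eqI[of _ _ "(h x, h y)"])
  qed
  then show ?thesis
    using assms finite_subset by blast
qed

text \<open>As in Schreier's lemma, right cosets of \<open>Z\<close> in \<open>[Q, Q]\<close> have representatives \<open>s r\<close> such that
  left multiplication by the finitely many commutators only produces factors from a finite set
  \<open>F \<subseteq> Z \<inter> [Q, Q]\<close>, which generates a finite group because \<open>Z \<inter> [Q, Q]\<close> has finite exponent.\<close>

lemma finite_derived:
  assumes "finite (carrier H)"
  shows "finite (derived G (carrier G))"
proof -
  let ?K = "G\<lparr>carrier := kernel G H h\<rparr>"
  interpret K: comm_group ?K by (rule comm_group_kernel)
  define D where "D = derived G (carrier G)"
  define C where "C = derived_set G (carrier G)"
  have D: "subgroup D G" unfolding D_def by (rule subgroup_derived)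
  interpret D: subgroup D G by fact
  have C: "finite C" "C \<subseteq> D" "C \<subseteq> carrier G"
    unfolding C_def D_def derived_def
    using finite_derived_set[OF assms] G.derived_set_in_carrier[of "carrier G"]
    by (auto intro: generate.incl)
  \<comment> \<open>The inverse of \<open>[x, y]\<close> is \<open>[y, x]\<close>. Hence the later
    induction over \<open>generate\<close> has to handle left multiplication by commutators
    only.\<close>
  have C_inv: "inv x \<in> C" if "x \<in> C" for x
    using that unfolding C_def
    by (auto simp: G.inv_mult_group G.m_assoc)
       (metis G.m_assoc G.inv_closed G.m_closed G.inv_inv)
  \<comment> \<open>The section is taken inside \<open>D\<close>, so that the factors in
    \<open>F\<close> lie in \<open>D\<close> as well as in the kernel, where
    \<open>kernel_derived_exponent\<close> applies.\<close>
  define s where "s = inv_into D h"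
  have s: "s r \<in> D" "h (s r) = r" if "r \<in> h ` D" for r
    using that unfolding s_def by (auto intro: inv_into_into f_inv_into_f)
  have hD: "finite (h ` D)"
    using assms D.subset by (auto intro!: finite_subset[of "h ` D" "carrier H"])
  have hDm: "h x \<otimes>\<^bsub>H\<^esub> r \<in> h ` D" if "x \<in> D" "r \<in> h ` D" for x r
    using that by (auto simp: image_iff) (metis D.m_closed D.mem_carrier hom_mult)
  define F where "F = (\<lambda>(x, r). inv (s (h x \<otimes>\<^bsub>H\<^esub> r)) \<otimes> (x \<otimes> s r)) ` (C \<times> h ` D)"
  have F: "finite F" "F \<subseteq> D" "F \<subseteq> kernel G H h"
  proof -
    show "finite F" using C hD by (simp add: F_def)
    show "F \<subseteq> D" using C s hDm by (auto simp: F_def)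
    show "F \<subseteq> kernel G H h"
    proof
      fix y assume "y \<in> F"
      then obtain x r where xr: "x \<in> C" "r \<in> h ` D" "y = inv (s (h x \<otimes>\<^bsub>H\<^esub> r)) \<otimes> (x \<otimes> s r)"
        by (auto simp: F_def)
      moreover have "r \<in> carrier H" using xr by auto
      moreover have "s r \<in> carrier G" "s (h x \<otimes>\<^bsub>H\<^esub> r) \<in> carrier G" "x \<in> carrier G"
        using xr s hDm C by (auto intro!: D.mem_carrier)
      moreover have "h (s (h x \<otimes>\<^bsub>H\<^esub> r)) = h x \<otimes>\<^bsub>H\<^esub> r"
        using s(2)[OF hDm[of x r]] xr C by auto
      ultimately show "y \<in> kernel G H h"
        using s(2) by (simp add: kernel_def)
    qed
  qed
  have "finite (generate ?K F)"
  proof (rule K.finite_generate)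
    show "x [^]\<^bsub>?K\<^esub> order H = \<one>\<^bsub>?K\<^esub>" if "x \<in> F" for x
      using kernel_derived_exponent[OF assms, of x] that F
      by (auto simp: D_def simp flip: G.nat_pow_consistent)
    show "order H > 0" using assms H.order_gt_0_iff_finite by blast
  qed (use F in auto)
  then have Y: "finite (generate G F)"
    using G.generate_consistent[OF F(3) subgroup_kernel] by simp
  have FG: "F \<subseteq> carrier G" using F(2) D.subset by blast
  define T where "T = (\<lambda>(r, y). s r \<otimes> y) ` (h ` D \<times> generate G F)"
  have T: "finite T" using Y hD by (simp add: T_def)
  \<comment> \<open>Left multiplication by \<open>x\<close> replaces \<open>s r\<close> by another
    representative and produces a factor from \<open>F\<close>, which \<open>generate G F\<close>
    absorbs.\<close>
  have CT: "x \<otimes> u \<in> T" if x: "x \<in> C" and "u \<in> T" for x u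
  proof -
    obtain r y where ry: "r \<in> h ` D" "y \<in> generate G F" "u = s r \<otimes> y"
      using \<open>u \<in> T\<close> by (auto simp: T_def)
    let ?v = "s (h x \<otimes>\<^bsub>H\<^esub> r)"
    have [simp]: "?v \<in> carrier G" "s r \<in> carrier G" "x \<in> carrier G" "y \<in> carrier G"
      using ry x C s hDm FG G.generate_in_carrier by (auto intro!: D.mem_carrier)
    have "x \<otimes> u = (?v \<otimes> inv ?v) \<otimes> (x \<otimes> s r) \<otimes> y"
      using ry by (simp add: G.m_assoc)
    also have "\<dots> = ?v \<otimes> ((inv ?v \<otimes> (x \<otimes> s r)) \<otimes> y)"
      by (simp only: G.m_assoc G.m_closed G.inv_closed \<open>?v \<in> carrier G\<close> \<open>s r \<in> carrier G\<close>
          \<open>x \<in> carrier G\<close> \<open>y \<in> carrier G\<close>)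
    finally have "x \<otimes> u = ?v \<otimes> ((inv ?v \<otimes> (x \<otimes> s r)) \<otimes> y)" .
    moreover have "inv ?v \<otimes> (x \<otimes> s r) \<in> F"
      unfolding F_def using x ry(1) by (intro image_eqI[of _ _ "(x, r)"]) auto
    then have "(inv ?v \<otimes> (x \<otimes> s r)) \<otimes> y \<in> generate G F"
      by (rule generate.eng[OF generate.incl ry(2)])
    moreover have "h x \<otimes>\<^bsub>H\<^esub> r \<in> h ` D"
      using hDm[of x r] ry(1) x C(2) by blast
    ultimately show ?thesis
      unfolding T_def by (intro image_eqI[of _ _ "(h x \<otimes>\<^bsub>H\<^esub> r, (inv ?v \<otimes> (x \<otimes> s r)) \<otimes> y)"]) auto
  qed
  have TG: "T \<subseteq> carrier G"
    using s(1) D.subset G.generate_incl[OF FG] by (auto simp: T_def subset_iff)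
  have DT: "d \<in> carrier G \<and> (\<forall>u\<in>T. d \<otimes> u \<in> T)" if "d \<in> D" for d
    using that unfolding D_def derived_def C_def[symmetric]
  proof (induction rule: generate.induct)
    case one
    then show ?case using TG by auto
  next
    case (incl x)
    then show ?case using CT C(3) by blast
  next
    case (inv x)
    then show ?case using CT C(3) C_inv by blast
  next
    case (eng d e)
    then show ?case using TG by (simp add: G.m_assoc subset_iff)
  qed
  \<comment> \<open>Since \<open>D\<close> maps \<open>T\<close> to itself, right multiplication by
    an element of \<open>T\<close> embeds \<open>D\<close> into the finite set \<open>T\<close>. Any
    element of \<open>T\<close> would serve as \<open>?e\<close>.\<close>
  let ?e = "s \<one>\<^bsub>H\<^esub>"
  have "\<one>\<^bsub>H\<^esub> \<in> h ` D"
    using D.one_closed hom_one by (metis image_eqI)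
  then have e: "?e \<in> carrier G" "?e \<in> T"
    using s(1)[of "\<one>\<^bsub>H\<^esub>"] D.subset generate.one[of G F]
    by (force simp: T_def)+
  then have "(\<lambda>d. d \<otimes> ?e) ` D \<subseteq> T"
    using DT by blast
  moreover have "inj_on (\<lambda>d. d \<otimes> ?e) D"
    using e D.subset by (auto simp: inj_on_def subset_iff)
  ultimately show ?thesis
    using T finite_imageD finite_subset unfolding D_def by blast
qed

text \<open>If \<open>order H = p ^ k\<close>, then \<open>p ^ k\<close>-th powers from the derived
  subgroup lie in the kernel, and the transfer kills their \<open>p ^ k\<close>-th powers. So the
  exponent divides \<open>p ^ (k + k)\<close>, while finiteness is Schur's theorem.\<close>

lemma finite_p_group_derived:
  assumes "Factorial_Ring.prime p" and "finite_p_group p H"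
  shows "finite_p_group p (G\<lparr>carrier := derived G (carrier G)\<rparr>)"
proof -
  obtain k where k: "order H = p ^ k"
    using assms(2) by (auto simp: finite_p_group_def)
  have fin: "finite (carrier H)"
    using k assms(1) H.order_gt_0_iff_finite by (simp add: prime_gt_0_nat)
  let ?D = "derived G (carrier G)"
  interpret D: subgroup ?D G by (rule subgroup_derived)
  interpret D: group "G\<lparr>carrier := ?D\<rparr>" by (simp add: subgroup_derived G.subgroup_imp_group)
  have "x [^] (p ^ (k + k)) = \<one>" if x: "x \<in> ?D" for x
  proof -
    have "x [^] (p ^ k) \<in> kernel G H h"
      using H.pow_order_eq_1[of "h x"] x by (simp add: kernel_def hom_nat_pow k)
    moreover have "x [^] (p ^ k) \<in> ?D"
      using x D.nat_pow_closed[of x "p ^ k"] by (simp flip: G.nat_pow_consistent)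
    ultimately show ?thesis
      using kernel_derived_exponent[OF fin, of "x [^] (p ^ k)"] x k
      by (simp add: G.nat_pow_pow power_add)
  qed
  then show ?thesis
    using D.order_prime_power[OF _ assms(1), of "k + k"] finite_derived[OF fin] D.is_group
    by (simp add: finite_p_group_def flip: G.nat_pow_consistent)
qed

end

subsection \<open>Central extensions of polycyclic groups\<close>

text \<open>Conjugation by \<open>t\<close> is a homomorphism, so it suffices to test
  generators.\<close>

lemma (in group) conj_generate_closed:
  assumes "subgroup P G" and "S \<subseteq> carrier G" and "t \<in> carrier G"
    and conj: "\<And>s. s \<in> S \<Longrightarrow> t \<otimes> s \<otimes> inv t \<in> P"
    and x: "x \<in> generate G S"
  shows "t \<otimes> x \<otimes> inv t \<in> P"
  using x
proof (induction rule: generate.induct)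
  case one
  then show ?case using assms(1,3) by (simp add: subgroup.one_closed)
next
  case (incl s)
  then show ?case by (rule conj)
next
  case (inv s)
  then have s: "s \<in> carrier G" using assms(2) by blast
  have "inv (t \<otimes> s \<otimes> inv t) \<in> P"
    by (rule subgroup.m_inv_closed[OF assms(1) conj[OF inv]])
  then show ?case using s assms(3) by (simp add: inv_mult_group m_assoc)
next
  case (eng x y)
  then have xy: "x \<in> carrier G" "y \<in> carrier G"
    using generate_in_carrier[OF assms(2)] by auto
  have "(t \<otimes> x \<otimes> inv t) \<otimes> (t \<otimes> y \<otimes> inv t) \<in> P"
    by (rule subgroup.m_closed[OF assms(1) eng.IH])
  moreover have "(t \<otimes> x \<otimes> inv t) \<otimes> (t \<otimes> y \<otimes> inv t) = t \<otimes> x \<otimes> (inv t \<otimes> (t \<otimes> (y \<otimes> inv t)))"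
    using xy assms(3) by (simp add: m_assoc)
  moreover have "inv t \<otimes> (t \<otimes> (y \<otimes> inv t)) = y \<otimes> inv t"
    using xy assms(3) by (simp flip: m_assoc)
  ultimately show ?case using xy assms(3) by (simp add: m_assoc)
qed

section \<open>Cyclic factors in terms of elements\<close>

text \<open>One step of a polycyclic series, written with elements of \<open>G\<close> alone to
  avoid quotients of groups with a changed carrier.\<close>

definition cyclic_extension :: "('a, 'b) monoid_scheme \<Rightarrow> 'a set \<Rightarrow> 'a set \<Rightarrow> bool"
  where "cyclic_extension G K L \<longleftrightarrow>
    subgroup K G \<and> subgroup L G \<and> K \<subseteq> L \<and>
    (\<forall>x\<in>L. \<forall>k\<in>K. x \<otimes>\<^bsub>G\<^esub> k \<otimes>\<^bsub>G\<^esub> inv\<^bsub>G\<^esub> x \<in> K) \<and>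
    (\<exists>t\<in>L. \<forall>x\<in>L. \<exists>i::int. x \<otimes>\<^bsub>G\<^esub> inv\<^bsub>G\<^esub> (t [^]\<^bsub>G\<^esub> i) \<in> K)"

lemma (in normal) group_hom_r_coset: "group_hom G (G Mod H) (\<lambda>x. H #> x)"
  by (intro group_hom.intro group_hom_axioms.intro is_group factorgroup_is_group r_coset_hom_Mod)

lemma (in group) rcos_eq_iff:
  assumes "subgroup K G" and "x \<in> carrier G" and "y \<in> carrier G"
  shows "K #> x = K #> y \<longleftrightarrow> x \<otimes> inv y \<in> K"
proof -
  have "K #> x = K #> y \<longleftrightarrow> x \<in> K #> y"
    using repr_independence[OF _ assms(3,1)] rcos_self[OF assms(2,1)] by blast
  then show ?thesis
    using subgroup.rcos_module[OF assms(1) is_group assms(3,2)] by simp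
qed

lemma (in normal) cyclic_FactGroup_iff:
  "cyclic_group (G Mod H) \<longleftrightarrow>
    (\<exists>t\<in>carrier G. \<forall>x\<in>carrier G. \<exists>i::int. x \<otimes> inv (t [^] i) \<in> H)"
proof -
  interpret Q: group "G Mod H" by (rule factorgroup_is_group)
  have eq: "H #> x = (H #> t) [^]\<^bsub>G Mod H\<^esub> i \<longleftrightarrow> x \<otimes> inv (t [^] i) \<in> H"
    if "x \<in> carrier G" "t \<in> carrier G" for x t and i :: int
  proof -
    have "H #> x = H #> (t [^] i) \<longleftrightarrow> x \<otimes> inv (t [^] i) \<in> H"
      using that by (simp add: rcos_eq_iff subgroup_axioms)
    then show ?thesis using that by (simp add: FactGroup_int_pow)
  qed
  show ?thesis
    unfolding Q.cyclic_group carrier_FactGroup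
  proof (intro iffI)
    assume "\<exists>T\<in>(\<lambda>x. H #> x) ` carrier G. (\<lambda>x. H #> x) ` carrier G = range (\<lambda>i::int. T [^]\<^bsub>G Mod H\<^esub> i)"
    then obtain t where t: "t \<in> carrier G"
      "(\<lambda>x. H #> x) ` carrier G = range (\<lambda>i::int. (H #> t) [^]\<^bsub>G Mod H\<^esub> i)" by auto
    have "\<exists>i::int. x \<otimes> inv (t [^] i) \<in> H" if "x \<in> carrier G" for x
    proof -
      have "H #> x \<in> range (\<lambda>i::int. (H #> t) [^]\<^bsub>G Mod H\<^esub> i)" using t(2) that by blast
      then show ?thesis using eq[OF that t(1)] by auto
    qed
    then show "\<exists>t\<in>carrier G. \<forall>x\<in>carrier G. \<exists>i::int. x \<otimes> inv (t [^] i) \<in> H" using t(1) by blast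
  next
    assume "\<exists>t\<in>carrier G. \<forall>x\<in>carrier G. \<exists>i::int. x \<otimes> inv (t [^] i) \<in> H"
    then obtain t where t: "t \<in> carrier G"
      "\<And>x. x \<in> carrier G \<Longrightarrow> \<exists>i::int. x \<otimes> inv (t [^] i) \<in> H" by blast
    have "(\<lambda>x. H #> x) ` carrier G = range (\<lambda>i::int. (H #> t) [^]\<^bsub>G Mod H\<^esub> i)"
    proof (intro equalityI subsetI)
      fix X assume "X \<in> (\<lambda>x. H #> x) ` carrier G"
      then obtain x where x: "x \<in> carrier G" "X = H #> x" by blast
      obtain i :: int where "x \<otimes> inv (t [^] i) \<in> H" using t(2)[OF x(1)] ..
      then have "X = (H #> t) [^]\<^bsub>G Mod H\<^esub> i" using eq[OF x(1) t(1)] x(2) by simp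
      then show "X \<in> range (\<lambda>i::int. (H #> t) [^]\<^bsub>G Mod H\<^esub> i)" by (rule range_eqI)
    next
      fix X assume "X \<in> range (\<lambda>i::int. (H #> t) [^]\<^bsub>G Mod H\<^esub> i)"
      then show "X \<in> (\<lambda>x. H #> x) ` carrier G"
        using t(1) by (auto simp: FactGroup_int_pow)
    qed
    then show "\<exists>T\<in>(\<lambda>x. H #> x) ` carrier G. (\<lambda>x. H #> x) ` carrier G = range (\<lambda>i::int. T [^]\<^bsub>G Mod H\<^esub> i)"
      using t(1) by blast
  qed
qed

text \<open>Through this equivalence both the introduction rule and the induction rule of
  \<open>polycyclic_seq\<close> can be stated with \<open>cyclic_extension\<close>.\<close>

lemma (in group) cyclic_extension_iff:
  "cyclic_extension G K L \<longleftrightarrow>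
    subgroup L G \<and> K \<lhd> G\<lparr>carrier := L\<rparr> \<and> cyclic_group (G\<lparr>carrier := L\<rparr> Mod K)"
proof (cases "subgroup L G")
  case True
  then interpret L: group "G\<lparr>carrier := L\<rparr>" by (rule subgroup_imp_group)
  have normal: "K \<lhd> G\<lparr>carrier := L\<rparr> \<longleftrightarrow>
      subgroup K G \<and> K \<subseteq> L \<and> (\<forall>x\<in>L. \<forall>k\<in>K. x \<otimes> k \<otimes> inv x \<in> K)"
  proof -
    have "subgroup K (G\<lparr>carrier := L\<rparr>) \<longleftrightarrow> subgroup K G \<and> K \<subseteq> L"
    proof
      assume "subgroup K (G\<lparr>carrier := L\<rparr>)"
      then show "subgroup K G \<and> K \<subseteq> L"
        using incl_subgroup[OF True] subgroup.subset by fastforce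
    next
      assume "subgroup K G \<and> K \<subseteq> L"
      then show "subgroup K (G\<lparr>carrier := L\<rparr>)" using subgroup_incl True by simp
    qed
    then show ?thesis
      using True by (auto simp: L.normal_inv_iff)
  qed
  moreover have "cyclic_group (G\<lparr>carrier := L\<rparr> Mod K) \<longleftrightarrow>
      (\<exists>t\<in>L. \<forall>x\<in>L. \<exists>i::int. x \<otimes> inv (t [^] i) \<in> K)" if "K \<lhd> G\<lparr>carrier := L\<rparr>"
    using normal.cyclic_FactGroup_iff[OF that] True
    by (simp add: subgroup_int_pow_closed flip: int_pow_consistent)
  ultimately show ?thesis
    using True unfolding cyclic_extension_def by blast
qed (simp add: cyclic_extension_def)

lemma (in group) polycyclic_seq_extend:
  assumes "polycyclic_seq G K" and "cyclic_extension G K L"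
  shows "polycyclic_seq G L"
proof -
  have "K \<lhd> G\<lparr>carrier := L\<rparr>" "subgroup L G" "cyclic_group (G\<lparr>carrier := L\<rparr> Mod K)"
    using assms(2) unfolding cyclic_extension_iff by blast+
  then show ?thesis by (rule polycyclic_seq.extension[OF assms(1)])
qed

lemma (in group) polycyclic_seq_induct [consumes 1, case_names unity extension]:
  assumes "polycyclic_seq G L" and "P {\<one>}"
    and "\<And>K L. \<lbrakk>polycyclic_seq G K; P K; cyclic_extension G K L\<rbrakk> \<Longrightarrow> P L"
  shows "P L"
  using assms(1)
proof (induction rule: polycyclic_seq.induct)
  case unity
  then show ?case by (rule assms(2))
next
  case (extension K L)
  have "cyclic_extension G K L"
    using extension.hyps unfolding cyclic_extension_iff by blast
  then show ?case by (rule assms(3)[OF extension.hyps(1) extension.IH])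
qed

lemma (in group) polycyclic_seq_imp_subgroup:
  "polycyclic_seq G K \<Longrightarrow> subgroup K G"
  by (induction rule: polycyclic_seq_induct)
     (auto simp: cyclic_extension_def intro: normal_imp_subgroup[OF one_is_normal])

text \<open>Series are built in the ambient group; this turns them into series of a subgroup as a
  group of its own. The factors stay the same, as only the last restriction of a carrier
  counts.\<close>

lemma (in group) polycyclic_seq_restrict:
  assumes "polycyclic_seq G K" and "K \<subseteq> A" and "subgroup A G"
  shows "polycyclic_seq (G\<lparr>carrier := A\<rparr>) K"
  using assms(1,2)
proof (induction)
  case unity
  then show ?case using polycyclic_seq.unity[of "G\<lparr>carrier := A\<rparr>"] by simp
next
  case (extension K L)
  have "K \<subseteq> L" using extension normal_imp_subgroup subgroup.subset by fastforce
  moreover have "subgroup L (G\<lparr>carrier := A\<rparr>)"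
    using extension assms(3) by (simp add: subgroup_incl)
  ultimately show ?case
    using extension polycyclic_seq.extension[of "G\<lparr>carrier := A\<rparr>" K L] by auto
qed

lemma (in group_hom) polycyclic_seq_image:
  assumes "polycyclic_seq G K"
  shows "polycyclic_seq H (h ` K)"
  using assms
proof (induction rule: G.polycyclic_seq_induct)
  case unity
  then show ?case using polycyclic_seq.unity[of H] by simp
next
  case (extension K L)
  have KL: "subgroup K G" "subgroup L G" "K \<subseteq> L"
    and normal: "\<And>x k. x \<in> L \<Longrightarrow> k \<in> K \<Longrightarrow> x \<otimes> k \<otimes> inv x \<in> K"
    using extension by (auto simp: cyclic_extension_def)
  obtain t where t: "t \<in> L" "\<And>x. x \<in> L \<Longrightarrow> \<exists>i::int. x \<otimes> inv (t [^] i) \<in> K"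
    using extension by (auto simp: cyclic_extension_def)
  have carr: "x \<in> carrier G" if "x \<in> L" for x by (rule subgroup.mem_carrier[OF KL(2) that])
  have "h x \<otimes>\<^bsub>H\<^esub> h k \<otimes>\<^bsub>H\<^esub> inv\<^bsub>H\<^esub> h x \<in> h ` K" if "x \<in> L" "k \<in> K" for x k
    using imageI[OF normal[OF that], of h] that KL(3) carr by (simp add: subset_iff)
  moreover have "\<exists>i::int. h x \<otimes>\<^bsub>H\<^esub> inv\<^bsub>H\<^esub> (h t [^]\<^bsub>H\<^esub> i) \<in> h ` K" if x: "x \<in> L" for x
  proof -
    obtain i :: int where i: "x \<otimes> inv (t [^] i) \<in> K" using t(2)[OF x] ..
    then show ?thesis
      using imageI[OF i, of h] carr x t(1) by (auto simp: hom_int_pow)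
  qed
  ultimately have "cyclic_extension H (h ` K) (h ` L)"
    using KL t(1) subgroup_img_is_subgroup unfolding cyclic_extension_def by blast
  then show ?case
    using extension.IH H.polycyclic_seq_extend by blast
qed

section \<open>Subgroups and generators of polycyclic groups\<close>

lemma int_subgroup_principal:
  fixes J :: "int set"
  assumes "0 \<in> J" and diff: "\<And>i j. i \<in> J \<Longrightarrow> j \<in> J \<Longrightarrow> i - j \<in> J"
  shows "\<exists>d\<in>J. \<forall>i\<in>J. d dvd i"
proof (cases "J = {0}")
  case False
  then obtain a where a: "a \<in> J" "a \<noteq> 0" using assms(1) by blast
  have neg: "- i \<in> J" if "i \<in> J" for i using diff[OF assms(1) that] by simp
  have add: "i + j \<in> J" if "i \<in> J" "j \<in> J" for i j using diff[OF that(1) neg[OF that(2)]] by simp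
  have mult: "i * int k \<in> J" if "i \<in> J" for i k
    by (induction k) (auto simp: assms(1) algebra_simps intro: add that)
  have mult': "i * k \<in> J" if "i \<in> J" for i k
    using mult[OF that, of "nat k"] mult[OF neg[OF that], of "nat (- k)"] by (cases "k \<ge> 0") auto
  \<comment> \<open>The least positive element divides all others: the remainder of \<open>i\<close>
    modulo \<open>d\<close> is again in \<open>J\<close> and smaller than \<open>d\<close>, hence
    zero.\<close>
  define d where "d = (LEAST k. k > 0 \<and> int k \<in> J)"
  have "\<exists>k>0. int k \<in> J"
    using a neg by (intro exI[of _ "nat \<bar>a\<bar>"]) (auto simp: abs_if)
  then have d: "d > 0" "int d \<in> J"
    unfolding d_def by (metis (mono_tags, lifting) LeastI)+
  have "int d dvd i" if "i \<in> J" for i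
  proof -
    have "i - int d * (i div int d) \<in> J" by (intro diff that mult' d)
    then have *: "int (nat (i mod int d)) \<in> J" using d(1) by (simp add: minus_mult_div_eq_mod)
    have "nat (i mod int d) < d" using d(1) by (simp add: nat_less_iff)
    then have "nat (i mod int d) = 0"
      using not_less_Least[of "nat (i mod int d)" "\<lambda>k. k > 0 \<and> int k \<in> J"] * unfolding d_def by auto
    moreover have "i mod int d \<ge> 0" using d(1) by simp
    ultimately show ?thesis by (simp add: dvd_eq_mod_eq_0)
  qed
  then show ?thesis using d(2) by blast
qed auto

text \<open>The exponents \<open>i\<close> with \<open>g [^] i\<close> in \<open>M\<close> form a
  subgroup of the integers, hence are the multiples of some \<open>d\<close>, and
  \<open>g [^] d\<close> generates \<open>M\<close>.\<close>

lemma (in group) subgroup_of_cyclic: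
  assumes "cyclic_group G" and "subgroup M G"
  shows "\<exists>c\<in>M. \<forall>x\<in>M. \<exists>i::int. x = c [^] i"
proof -
  obtain g where g: "g \<in> carrier G" "carrier G = range (\<lambda>i::int. g [^] i)"
    using assms(1) cyclic_group by blast
  have "\<exists>d\<in>{i::int. g [^] i \<in> M}. \<forall>i\<in>{i. g [^] i \<in> M}. d dvd i"
    by (rule int_subgroup_principal)
       (use g(1) assms(2) in \<open>auto simp: int_pow_diff subgroup.one_closed subgroup.m_closed subgroup.m_inv_closed\<close>)
  then obtain d :: int where d: "g [^] d \<in> M" "\<And>i. g [^] i \<in> M \<Longrightarrow> d dvd i" by auto
  have "\<exists>i::int. x = (g [^] d) [^] i" if "x \<in> M" for x
  proof -
    have "x \<in> carrier G" by (rule subgroup.mem_carrier[OF assms(2) that])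
    then obtain i where i: "x = g [^] (i::int)" unfolding g(2) by (rule rangeE)
    then have "d dvd i" using d(2)[of i] that by simp
    then obtain j where "i = d * j" by (rule dvdE)
    then have "x = (g [^] d) [^] j" using i g(1) by (simp add: int_pow_pow)
    then show ?thesis by blast
  qed
  then show ?thesis using d(1) by blast
qed

text \<open>The factor of the intersections embeds into the cyclic group \<open>L / K\<close>. Its
  image there is cyclic, and \<open>u\<close> lifts a generator of that image.\<close>

lemma (in group) cyclic_extension_Int:
  assumes "cyclic_extension G K L" and M: "subgroup M G"
  shows "cyclic_extension G (M \<inter> K) (M \<inter> L)"
proof -
  have KL: "subgroup K G" "subgroup L G" "K \<subseteq> L"
    and conj: "\<And>x k. x \<in> L \<Longrightarrow> k \<in> K \<Longrightarrow> x \<otimes> k \<otimes> inv x \<in> K"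
    using assms(1) by (auto simp: cyclic_extension_def)
  have N: "K \<lhd> G\<lparr>carrier := L\<rparr>" and C: "cyclic_group (G\<lparr>carrier := L\<rparr> Mod K)"
    using assms(1) unfolding cyclic_extension_iff by blast+
  interpret L: group "G\<lparr>carrier := L\<rparr>" using KL(2) by (rule subgroup_imp_group)
  interpret N: normal K "G\<lparr>carrier := L\<rparr>" by (rule N)
  interpret Q: group "G\<lparr>carrier := L\<rparr> Mod K" by (rule N.factorgroup_is_group)
  define \<phi> where "\<phi> x = K #>\<^bsub>G\<lparr>carrier := L\<rparr>\<^esub> x" for x
  interpret \<phi>: group_hom "G\<lparr>carrier := L\<rparr>" "G\<lparr>carrier := L\<rparr> Mod K" \<phi>
    unfolding \<phi>_def[abs_def] by (rule N.group_hom_r_coset)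
  have sub: "subgroup (M \<inter> L) (G\<lparr>carrier := L\<rparr>)"
    using subgroup_incl[OF subgroups_Inter_pair[OF M KL(2)] KL(2)] by simp
  obtain c where c: "c \<in> \<phi> ` (M \<inter> L)"
    "\<And>y. y \<in> \<phi> ` (M \<inter> L) \<Longrightarrow> \<exists>i::int. y = c [^]\<^bsub>G\<lparr>carrier := L\<rparr> Mod K\<^esub> i"
    using Q.subgroup_of_cyclic[OF C \<phi>.subgroup_img_is_subgroup[OF sub]] by blast
  then obtain u where u: "u \<in> M \<inter> L" "c = \<phi> u" by blast
  have pow: "u [^] (i::int) \<in> M \<inter> L" for i
    using subgroup_int_pow_closed[OF subgroups_Inter_pair[OF M KL(2)] u(1)] .
  have "\<exists>i::int. x \<otimes> inv (u [^] i) \<in> M \<inter> K" if x: "x \<in> M \<inter> L" for x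
  proof -
    obtain i :: int where "\<phi> x = \<phi> u [^]\<^bsub>G\<lparr>carrier := L\<rparr> Mod K\<^esub> i"
      using c(2)[of "\<phi> x"] x u(2) by blast
    then have "\<phi> x = \<phi> (u [^] i)"
      using u(1) \<phi>.hom_int_pow[of u i] int_pow_consistent[OF KL(2), of u i] by simp
    then have "x \<otimes> inv (u [^] i) \<in> K"
      using L.rcos_eq_iff[OF N.subgroup_axioms, of x "u [^] i"] x pow[of i] KL(2)
      by (simp add: \<phi>_def)
    moreover have "x \<otimes> inv (u [^] i) \<in> M"
      using x pow[of i] M by (simp add: subgroup.m_closed subgroup.m_inv_closed)
    ultimately show ?thesis by blast
  qed
  moreover have "x \<otimes> k \<otimes> inv x \<in> M \<inter> K" if "x \<in> M \<inter> L" "k \<in> M \<inter> K" for x k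
    using that conj M by (auto simp: subgroup.m_closed subgroup.m_inv_closed)
  moreover have "subgroup (M \<inter> K) G" "subgroup (M \<inter> L) G" "M \<inter> K \<subseteq> M \<inter> L"
    using KL M subgroups_Inter_pair by auto
  ultimately show ?thesis
    using u(1) unfolding cyclic_extension_def by (intro conjI ballI bexI[of _ u]) simp_all
qed

lemma (in group) polycyclic_seq_Int:
  assumes "polycyclic_seq G L" and "subgroup M G"
  shows "polycyclic_seq G (M \<inter> L)"
  using assms(1)
proof (induction rule: polycyclic_seq_induct)
  case unity
  then show ?case
    using subgroup.one_closed[OF assms(2)] polycyclic_seq.unity[of G] by (simp add: Int_absorb1)
next
  case (extension K L)
  show ?case
    by (rule polycyclic_seq_extend[OF extension.IH cyclic_extension_Int[OF extension.hyps(2) assms(2)]])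
qed

lemma (in group) cyclic_extension_generator:
  assumes "cyclic_extension G K L"
  obtains t where "t \<in> L" "\<And>x. x \<in> L \<Longrightarrow> \<exists>k\<in>K. \<exists>i::int. x = k \<otimes> t [^] i"
proof -
  have L: "subgroup L G" using assms by (simp add: cyclic_extension_def)
  obtain t where t: "t \<in> L" "\<And>x. x \<in> L \<Longrightarrow> \<exists>i::int. x \<otimes> inv (t [^] i) \<in> K"
    using assms unfolding cyclic_extension_def by blast
  have "\<exists>k\<in>K. \<exists>i::int. x = k \<otimes> t [^] i" if x: "x \<in> L" for x
  proof -
    obtain i :: int where "x \<otimes> inv (t [^] i) \<in> K" using t(2)[OF x] ..
    moreover have "x = (x \<otimes> inv (t [^] i)) \<otimes> t [^] i"
      using subgroup.mem_carrier[OF L x] subgroup.mem_carrier[OF L t(1)] by (simp add: m_assoc)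
    ultimately show ?thesis by blast
  qed
  then show thesis using that t(1) by blast
qed

text \<open>Each cyclic step adds one generator. This keeps the set of central corrections in
  \<open>polycyclic_seq_lift\<close> finite.\<close>

lemma (in group) polycyclic_seq_imp_finitely_generated:
  assumes "polycyclic_seq G L"
  shows "\<exists>S. finite S \<and> S \<subseteq> carrier G \<and> L = generate G S"
  using assms
proof (induction rule: polycyclic_seq_induct)
  case unity
  then show ?case using generate_empty by blast
next
  case (extension K L)
  then obtain S where S: "finite S" "S \<subseteq> carrier G" "K = generate G S" by blast
  obtain t where t: "t \<in> L" "\<And>x. x \<in> L \<Longrightarrow> \<exists>k\<in>K. \<exists>i::int. x = k \<otimes> t [^] i"
    using cyclic_extension_generator[OF extension(2)] by blast
  have L: "subgroup L G" "K \<subseteq> L" using extension(2) by (auto simp: cyclic_extension_def)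
  have tG: "t \<in> carrier G" by (rule subgroup.mem_carrier[OF L(1) t(1)])
  have sub: "subgroup (generate G (insert t S)) G"
    using S(2) tG by (intro generate_is_subgroup) auto
  have "L = generate G (insert t S)"
  proof
    show "generate G (insert t S) \<subseteq> L"
      using S L t(1) generate.incl[of _ S G] by (intro generate_subgroup_incl) auto
    show "L \<subseteq> generate G (insert t S)"
    proof
      fix x assume "x \<in> L"
      then obtain k i where k: "k \<in> K" "x = k \<otimes> t [^] (i::int)" using t(2) by blast
      have "k \<in> generate G (insert t S)"
        using k(1) S(3) mono_generate[of S "insert t S"] by blast
      moreover have "t [^] i \<in> generate G (insert t S)"
        by (intro subgroup_int_pow_closed[OF sub] generate.incl) simp
      ultimately show "x \<in> generate G (insert t S)"
        unfolding k(2) by (rule generate.eng)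
    qed
  qed
  then show ?case using S tG by (intro exI[of _ "insert t S"]) auto
qed

text \<open>The two conjugation conditions put \<open>t\<close> into the normalizer \<open>N\<close>
  of \<open>K\<close>; one direction alone could map an infinite \<open>K\<close> properly into
  itself.\<close>

lemma (in group) cyclic_extension_generate:
  assumes K: "subgroup K G" and t: "t \<in> carrier G"
    and conj: "\<And>k. k \<in> K \<Longrightarrow> t \<otimes> k \<otimes> inv t \<in> K" "\<And>k. k \<in> K \<Longrightarrow> inv t \<otimes> k \<otimes> t \<in> K"
  shows "cyclic_extension G K (generate G (insert t K))"
proof -
  interpret K: subgroup K G by fact
  define N where "N = {x \<in> carrier G. \<forall>k\<in>K. x \<otimes> k \<otimes> inv x \<in> K \<and> inv x \<otimes> k \<otimes> x \<in> K}"
  have N: "subgroup N G"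
  proof (rule subgroupI)
    show "N \<subseteq> carrier G" by (auto simp: N_def)
    show "N \<noteq> {}" unfolding N_def using K.mem_carrier by force
    show "inv x \<in> N" if "x \<in> N" for x using that by (auto simp: N_def)
    show "x \<otimes> y \<in> N" if "x \<in> N" "y \<in> N" for x y
    proof -
      have xy: "x \<in> carrier G" "y \<in> carrier G" using that by (auto simp: N_def)
      have "x \<otimes> (y \<otimes> k \<otimes> inv y) \<otimes> inv x \<in> K" "inv y \<otimes> (inv x \<otimes> k \<otimes> x) \<otimes> y \<in> K" if "k \<in> K" for k
        using \<open>x \<in> N\<close> \<open>y \<in> N\<close> that by (auto simp: N_def)
      then show ?thesis
        using xy K.mem_carrier by (simp add: N_def m_assoc inv_mult_group)
    qed
  qed
  have "t \<in> N" using t conj by (auto simp: N_def)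
  moreover have "K \<subseteq> N" by (auto simp: N_def)
  ultimately have LN: "generate G (insert t K) \<subseteq> N"
    using N by (intro generate_subgroup_incl) auto
  let ?L = "generate G (insert t K)"
  have L: "subgroup ?L G" using t K.subset by (intro generate_is_subgroup) auto
  have tN: "t [^] (i::int) \<in> N" for i using N \<open>t \<in> N\<close> by (rule subgroup_int_pow_closed)
  have "x \<in> carrier G \<and> (\<exists>i::int. x \<otimes> inv (t [^] i) \<in> K)" if "x \<in> ?L" for x
    using that
  proof (induction rule: generate.induct)
    case one
    then show ?case by (auto intro!: exI[of _ "0::int"])
  next
    case (incl x)
    then consider "x = t" | "x \<in> K" by blast
    then show ?case
    proof cases
      case 1
      then show ?thesis using t by (auto intro!: exI[of _ "1::int"])
    next
      case 2
      then show ?thesis by (auto intro!: exI[of _ "0::int"])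
    qed
  next
    case (inv x)
    then consider "x = t" | "x \<in> K" by blast
    then show ?case
    proof cases
      case 1
      then show ?thesis using t by (auto intro!: exI[of _ "-1::int"] simp: int_pow_neg)
    next
      case 2
      then show ?thesis by (auto intro!: exI[of _ "0::int"])
    qed
  next
    case (eng x y)
    then obtain i j :: int where ij: "x \<otimes> inv (t [^] i) \<in> K" "y \<otimes> inv (t [^] j) \<in> K"
      and xy: "x \<in> carrier G" "y \<in> carrier G" by blast
    \<comment> \<open>With \<open>x = k t^i\<close> and \<open>y = k' t^j\<close> the product is
      \<open>k (t^i k' t^-i) t^(i+j)\<close>, and \<open>t^i\<close> normalizes
      \<open>K\<close>.\<close>
    have "t [^] i \<otimes> (y \<otimes> inv (t [^] j)) \<otimes> inv (t [^] i) \<in> K"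
      using tN[of i] ij(2) by (auto simp: N_def)
    then have "(x \<otimes> inv (t [^] i)) \<otimes> (t [^] i \<otimes> (y \<otimes> inv (t [^] j)) \<otimes> inv (t [^] i)) \<in> K"
      by (rule K.m_closed[OF ij(1)])
    moreover have "(x \<otimes> inv (t [^] i)) \<otimes> (t [^] i \<otimes> (y \<otimes> inv (t [^] j)) \<otimes> inv (t [^] i))
        = x \<otimes> ((inv (t [^] i) \<otimes> t [^] i) \<otimes> (y \<otimes> (inv (t [^] j) \<otimes> inv (t [^] i))))"
      using xy t by (simp only: m_assoc m_closed inv_closed int_pow_closed)
    moreover have "\<dots> = (x \<otimes> y) \<otimes> inv (t [^] (i + j))"
      using xy t by (simp add: m_assoc int_pow_mult inv_mult_group)
    ultimately show ?case using xy by auto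
  qed
  moreover have "t \<in> ?L" "K \<subseteq> ?L"
    by (auto intro: generate.incl)
  moreover have "x \<otimes> k \<otimes> inv x \<in> K" if "x \<in> ?L" "k \<in> K" for x k
    using LN that by (auto simp: N_def)
  ultimately show ?thesis
    using K L unfolding cyclic_extension_def by (intro conjI ballI bexI[of _ t]) simp_all
qed

lemma polycyclic_epi_image:
  assumes "polycyclic G" and "group H" and "f \<in> epi G H"
  shows "polycyclic H"
proof -
  interpret group_hom G H f
    using assms unfolding polycyclic_def epi_def
    by (intro group_hom.intro group_hom_axioms.intro) blast+
  show ?thesis
    using polycyclic_seq_image[of "carrier G"] assms unfolding polycyclic_def epi_def by simp
qed

section \<open>Lifting polycyclic groups through central extensions\<close>

context central_extension
begin

text \<open>Conjugation by a central element is trivial, so each element of \<open>W\<close> adds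
  one cyclic factor on top.\<close>

lemma polycyclic_seq_adjoin_central:
  assumes "finite W" and "W \<subseteq> kernel G H h" and "S \<subseteq> carrier G"
    and "polycyclic_seq G (generate G S)"
  shows "polycyclic_seq G (generate G (W \<union> S))"
  using assms(1,2)
proof (induction W rule: finite_induct)
  case empty
  then show ?case using assms(4) by simp
next
  case (insert w W)
  let ?P = "generate G (W \<union> S)"
  have w: "w \<in> kernel G H h" "w \<in> carrier G" and WS: "W \<union> S \<subseteq> carrier G"
    using insert.prems assms(3) by (auto simp: kernel_def)
  have P: "subgroup ?P G" by (rule G.generate_is_subgroup[OF WS])
  have conj: "w \<otimes> k \<otimes> inv w = k" "inv w \<otimes> k \<otimes> w = k" if "k \<in> ?P" for k
  proof -
    have k: "k \<in> carrier G" using G.generate_in_carrier[OF WS that] .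
    show "w \<otimes> k \<otimes> inv w = k"
      using central[OF w(1) k] k w(2) by (simp add: G.m_assoc)
    have "inv w \<otimes> k \<otimes> w = inv w \<otimes> (w \<otimes> k)"
      using central[OF w(1) k] k w(2) by (simp add: G.m_assoc)
    then show "inv w \<otimes> k \<otimes> w = k" using k w(2) by (simp flip: G.m_assoc)
  qed
  have "cyclic_extension G ?P (generate G (insert w ?P))"
    by (rule G.cyclic_extension_generate[OF P w(2)]) (simp_all add: conj)
  then have "polycyclic_seq G (generate G (insert w ?P))"
    using insert G.polycyclic_seq_extend by auto
  moreover have "generate G (insert w ?P) = generate G (insert w W \<union> S)"
  proof
    have "subgroup (generate G (insert w W \<union> S)) G"
      using w WS by (intro G.generate_is_subgroup) auto
    moreover have "?P \<subseteq> generate G (insert w W \<union> S)" by (rule G.mono_generate) auto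
    ultimately show "generate G (insert w ?P) \<subseteq> generate G (insert w W \<union> S)"
      by (intro G.generate_subgroup_incl) (auto intro: generate.incl)
    show "generate G (insert w W \<union> S) \<subseteq> generate G (insert w ?P)"
      by (rule G.mono_generate) (auto intro: generate.incl)
  qed
  ultimately show ?case by simp
qed

text \<open>A lift \<open>t\<close> of a generator of the cyclic factor normalizes the lift \<open>P\<close> of \<open>K\<close> only up to central
  elements. As \<open>P\<close> is finitely generated, finitely many of these, the set \<open>W\<close>, have to be adjoined.\<close>

lemma polycyclic_seq_lift:
  assumes "polycyclic_seq H K"
  shows "\<exists>P. polycyclic_seq G P \<and> h ` P = K"
  using assms
proof (induction rule: H.polycyclic_seq_induct)
  case unity
  then show ?case using polycyclic_seq.unity[of G] by (intro exI[of _ "{\<one>}"]) simp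
next
  case (extension K L)
  then obtain P where P: "polycyclic_seq G P" "h ` P = K" by blast
  obtain S where S: "finite S" "S \<subseteq> carrier G" "P = generate G S"
    using G.polycyclic_seq_imp_finitely_generated[OF P(1)] by blast
  have KL: "subgroup K H" "subgroup L H" "K \<subseteq> L"
    and normal: "\<And>x k. x \<in> L \<Longrightarrow> k \<in> K \<Longrightarrow> x \<otimes>\<^bsub>H\<^esub> k \<otimes>\<^bsub>H\<^esub> inv\<^bsub>H\<^esub> x \<in> K"
    using extension(2) by (auto simp: cyclic_extension_def)
  obtain l where l: "l \<in> L" "\<And>x. x \<in> L \<Longrightarrow> \<exists>k\<in>K. \<exists>i::int. x = k \<otimes>\<^bsub>H\<^esub> l [^]\<^bsub>H\<^esub> i"
    using H.cyclic_extension_generator[OF extension(2)] by blast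
  have "l \<in> h ` carrier G" unfolding surj by (rule subgroup.mem_carrier[OF KL(2) l(1)])
  then obtain t where t: "t \<in> carrier G" "h t = l" by auto
  have ht: "h u \<in> L" if "u = t \<or> u = inv t" for u
    using that t l(1) subgroup.m_inv_closed[OF KL(2)] by auto
  \<comment> \<open>The conjugate of \<open>s\<close> has the same image as some \<open>p\<close> in
    \<open>P\<close>, and \<open>w\<close> is their central quotient. Both \<open>t\<close> and
    \<open>inv t\<close> are treated because \<open>cyclic_extension_generate\<close> asks for both
    directions.\<close>
  have "\<exists>w\<in>kernel G H h. inv w \<otimes> (u \<otimes> s \<otimes> inv u) \<in> P"
    if u: "u = t \<or> u = inv t" and s: "s \<in> S" for u s
  proof -
    have uG: "u \<in> carrier G" using u t by auto
    have sG: "s \<in> carrier G" using s S by auto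
    have "h s \<in> K" using P(2) S(3) s generate.incl[of s S G] by auto
    then have "h (u \<otimes> s \<otimes> inv u) \<in> h ` P"
      using normal[OF ht[OF u]] P(2) uG sG by simp
    then obtain p where p: "p \<in> P" "h (u \<otimes> s \<otimes> inv u) = h p" by auto
    have pG: "p \<in> carrier G" using p(1) G.generate_in_carrier[OF S(2)] S(3) by simp
    let ?w = "(u \<otimes> s \<otimes> inv u) \<otimes> inv p"
    have "?w \<in> kernel G H h" using kernel_quotient(1)[OF _ pG p(2)] uG sG by simp
    moreover have "inv ?w \<otimes> (u \<otimes> s \<otimes> inv u) = p"
    proof -
      have "inv (c \<otimes> inv p) \<otimes> c = p" if "c \<in> carrier G" for c
        using that pG by (simp add: G.inv_mult_group G.m_assoc)
      then show ?thesis using uG sG by simp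
    qed
    ultimately show ?thesis using p(1) by (intro bexI[of _ ?w]) simp_all
  qed
  then have "\<forall>u\<in>{t, inv t}. \<forall>s\<in>S. \<exists>w. w \<in> kernel G H h \<and> inv w \<otimes> (u \<otimes> s \<otimes> inv u) \<in> P"
    by blast
  then obtain w where w: "\<forall>u\<in>{t, inv t}. \<forall>s\<in>S.
      w u s \<in> kernel G H h \<and> inv (w u s) \<otimes> (u \<otimes> s \<otimes> inv u) \<in> P"
    unfolding bchoice_iff by blast
  define W where "W = w t ` S \<union> w (inv t) ` S"
  have W: "finite W" "W \<subseteq> kernel G H h" using S(1) w by (auto simp: W_def)
  have WG: "W \<subseteq> carrier G" using W(2) by (auto simp: kernel_def)
  let ?Q = "generate G (W \<union> S)"
  have WSG: "W \<union> S \<subseteq> carrier G" using WG S(2) by auto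
  have Q: "polycyclic_seq G ?Q"
    using polycyclic_seq_adjoin_central[OF W S(2)] P(1) S(3) by blast
  have Qsub: "subgroup ?Q G" by (rule G.generate_is_subgroup[OF WSG])
  have PQ: "P \<subseteq> ?Q" unfolding S(3) by (rule G.mono_generate) auto
  \<comment> \<open>On \<open>W\<close> the conjugation is trivial; on \<open>S\<close> it gives a
    correction from \<open>W\<close> times an element of \<open>P\<close>.\<close>
  have conj: "u \<otimes> x \<otimes> inv u \<in> ?Q" if u: "u = t \<or> u = inv t" and x: "x \<in> ?Q" for u x
  proof (rule G.conj_generate_closed[OF Qsub WSG _ _ x])
    show uG: "u \<in> carrier G" using u t by auto
    fix s assume "s \<in> W \<union> S"
    then show "u \<otimes> s \<otimes> inv u \<in> ?Q"
    proof
      assume s: "s \<in> W"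
      then have "s \<in> carrier G" "u \<otimes> s = s \<otimes> u"
        using WG W(2) central[OF _ uG, of s, symmetric] by blast+
      then have "u \<otimes> s \<otimes> inv u = s" using uG by (simp add: G.m_assoc)
      then show ?thesis using s by (auto intro: generate.incl)
    next
      assume s: "s \<in> S"
      have "w u s \<in> W" using s u by (auto simp: W_def)
      then have "w u s \<in> ?Q" "w u s \<in> carrier G" using WG by (auto intro: generate.incl)
      moreover have "inv (w u s) \<otimes> (u \<otimes> s \<otimes> inv u) \<in> ?Q" using w u s PQ by auto
      ultimately have "w u s \<otimes> (inv (w u s) \<otimes> (u \<otimes> s \<otimes> inv u)) \<in> ?Q"
        by - (rule generate.eng)
      moreover have "w u s \<otimes> (inv (w u s) \<otimes> (u \<otimes> s \<otimes> inv u)) = u \<otimes> s \<otimes> inv u"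
        using \<open>w u s \<in> carrier G\<close> uG s S(2) by (simp add: subset_iff flip: G.m_assoc)
      ultimately show ?thesis by simp
    qed
  qed
  let ?R = "generate G (insert t ?Q)"
  have ext: "cyclic_extension G ?Q ?R"
    using conj[of t] conj[of "inv t"] t(1)
    by (intro G.cyclic_extension_generate Qsub) auto
  have R: "subgroup ?R G" using ext by (simp add: cyclic_extension_def)
  \<comment> \<open>The corrections in \<open>W\<close> map to the identity, so adjoining them does
    not enlarge the image.\<close>
  have "h ` ?R = L"
  proof
    have "h ` S \<subseteq> K" using P(2) S(3) generate.incl[of _ S G] by auto
    moreover have "h ` W \<subseteq> K"
      using W(2) subgroup.one_closed[OF KL(1)] by (auto simp: kernel_def)
    ultimately have "generate H (h ` (W \<union> S)) \<subseteq> L"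
      using KL by (intro H.generate_subgroup_incl) auto
    then have "h ` ?Q \<subseteq> L" using generate_img[OF WSG] by simp
    then have "generate H (h ` insert t ?Q) \<subseteq> L"
      using KL(2) t l(1) by (intro H.generate_subgroup_incl) auto
    moreover have "insert t ?Q \<subseteq> carrier G" using t(1) G.generate_incl[OF WSG] by auto
    ultimately show "h ` ?R \<subseteq> L" using generate_img[of "insert t ?Q"] by simp
    show "L \<subseteq> h ` ?R"
    proof
      fix x assume "x \<in> L"
      then obtain k i where k: "k \<in> K" "x = k \<otimes>\<^bsub>H\<^esub> l [^]\<^bsub>H\<^esub> (i::int)" using l(2) by blast
      then obtain p where p: "p \<in> P" "h p = k" using P(2) by auto
      have "p \<in> ?R" using p(1) PQ generate.incl[of p "insert t ?Q" G] by auto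
      moreover have "t [^] i \<in> ?R"
        by (intro G.subgroup_int_pow_closed[OF R] generate.incl) simp
      ultimately have "p \<otimes> t [^] i \<in> ?R" by (rule generate.eng)
      moreover have "h (p \<otimes> t [^] i) = x"
        using p t k(2) G.generate_in_carrier[OF S(2)] S(3) by (simp add: hom_int_pow)
      ultimately show "x \<in> h ` ?R" by (intro image_eqI[of _ h "p \<otimes> t [^] i"]) simp_all
    qed
  qed
  then show ?case using G.polycyclic_seq_extend[OF Q ext] by blast
qed

text \<open>For a polycyclic lift \<open>P\<close> of all of \<open>H\<close>,
  \<open>derived_eq\<close> places the derived subgroup inside \<open>P\<close>, and subgroups
  inherit the series by intersection.\<close>

lemma polycyclic_derived:
  assumes "polycyclic H"
  shows "polycyclic (G\<lparr>carrier := derived G (carrier G)\<rparr>)"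
proof -
  obtain P where P: "polycyclic_seq G P" "h ` P = carrier H"
    using polycyclic_seq_lift[of "carrier H"] assms unfolding polycyclic_def by blast
  let ?D = "derived G (carrier G)"
  have "subgroup P G" by (rule G.polycyclic_seq_imp_subgroup[OF P(1)])
  then have "?D \<subseteq> P" using derived_eq P(2) G.derived_incl by blast
  then have "polycyclic_seq G ?D"
    using G.polycyclic_seq_Int[OF P(1) subgroup_derived] by (simp add: Int_absorb2)
  then show ?thesis
    using G.polycyclic_seq_restrict[of ?D ?D] subgroup_derived
    by (simp add: polycyclic_def G.subgroup_imp_group)
qed

end

section \<open>Epimorphic images of finite \<open>p\<close>-groups and of perfect groups\<close>

text \<open>The exponent bound \<open>p ^ k\<close> passes to the image, where
  \<open>order_prime_power\<close> recovers the order.\<close>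

lemma finite_p_group_epi_image:
  assumes "finite_p_group p G" and "Factorial_Ring.prime p" and "group H" and "f \<in> epi G H"
  shows "finite_p_group p H"
proof -
  have f: "f \<in> hom G H" "f ` carrier G = carrier H" using assms(4) by (auto simp: epi_def)
  obtain k where k: "group G" "order G = p ^ k" using assms(1) by (auto simp: finite_p_group_def)
  interpret group_hom G H f
    by (intro group_hom.intro group_hom_axioms.intro k(1) assms(3) f(1))
  have "finite (carrier G)"
    using k(2) assms(2) G.order_gt_0_iff_finite by (simp add: prime_gt_0_nat)
  then have "finite (carrier H)" using f(2) by (metis finite_imageI)
  moreover have "y [^]\<^bsub>H\<^esub> (p ^ k) = \<one>\<^bsub>H\<^esub>" if y: "y \<in> carrier H" for y
  proof -
    obtain x where x: "x \<in> carrier G" "y = f x" using y f(2) by auto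
    then have "f (x [^]\<^bsub>G\<^esub> (p ^ k)) = \<one>\<^bsub>H\<^esub>" using G.pow_order_eq_1[of x] k(2) by simp
    then show ?thesis using x by (simp add: hom_nat_pow)
  qed
  ultimately have "\<exists>l. order H = p ^ l"
    by (rule H.order_prime_power[OF _ assms(2)])
  then show ?thesis using assms(3) by (simp add: finite_p_group_def)
qed

lemma perfect_epi_image:
  assumes "perfect_group G" and "group H" and "f \<in> epi G H"
  shows "perfect_group H"
proof -
  have f: "f \<in> hom G H" "f ` carrier G = carrier H" using assms(3) by (auto simp: epi_def)
  interpret group_hom G H f
    using assms(1) f(1) assms(2)
    by (simp add: group_hom_def group_hom_axioms_def perfect_group_def)
  show ?thesis
    using derived_img[of "carrier G"] assms f(2) by (simp add: perfect_group_def)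
qed

subsection \<open>Descent along the derived series\<close>

text \<open>The homomorphism theorem for any epimorphism \<open>r\<close> in place of a quotient
  projection. It provides maps between quotients, from \<open>G\<close> to a quotient of
  \<open>H\<close>, and out of the quotient by the trivial group.\<close>

lemma hom_factor:
  assumes "group_hom K A q" and "group_hom K B r" and surj: "r ` carrier K = carrier B"
    and ker: "\<And>x. \<lbrakk>x \<in> carrier K; r x = \<one>\<^bsub>B\<^esub>\<rbrakk> \<Longrightarrow> q x = \<one>\<^bsub>A\<^esub>"
  obtains f where "f \<in> hom B A" and "\<And>x. x \<in> carrier K \<Longrightarrow> f (r x) = q x"
proof -
  interpret q: group_hom K A q by fact
  interpret r: group_hom K B r by fact
  have eq: "q x = q y" if "x \<in> carrier K" "y \<in> carrier K" "r x = r y" for x y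
  proof -
    have "q (x \<otimes>\<^bsub>K\<^esub> inv\<^bsub>K\<^esub> y) = \<one>\<^bsub>A\<^esub>" using that by (intro ker) simp_all
    then have "q x \<otimes>\<^bsub>A\<^esub> inv\<^bsub>A\<^esub> q y = \<one>\<^bsub>A\<^esub>" using that by simp
    then show ?thesis
      using that q.H.inv_equality[of "q x" "inv\<^bsub>A\<^esub> q y"] by simp
  qed
  define f where "f b = q (inv_into (carrier K) r b)" for b
  have f: "f (r x) = q x" if "x \<in> carrier K" for x
    unfolding f_def using that
    by (intro eq) (auto intro: inv_into_into f_inv_into_f)
  have "f \<in> hom B A"
  proof (rule homI)
    fix b assume "b \<in> carrier B"
    then obtain x where "x \<in> carrier K" "b = r x" using surj by blast
    then show "f b \<in> carrier A" using f by simp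
  next
    fix b c assume "b \<in> carrier B" "c \<in> carrier B"
    then obtain x y where xy: "x \<in> carrier K" "b = r x" "y \<in> carrier K" "c = r y"
      using surj by blast
    then have "f (b \<otimes>\<^bsub>B\<^esub> c) = f (r (x \<otimes>\<^bsub>K\<^esub> y))" by simp
    also have "\<dots> = q (x \<otimes>\<^bsub>K\<^esub> y)" using xy by (intro f) simp
    also have "\<dots> = f b \<otimes>\<^bsub>A\<^esub> f c" using xy f by simp
    finally show "f (b \<otimes>\<^bsub>B\<^esub> c) = f b \<otimes>\<^bsub>A\<^esub> f c" .
  qed
  then show thesis using that f by blast
qed

lemma (in normal) r_coset_eq_one_iff:
  "x \<in> carrier G \<Longrightarrow> H #> x = \<one>\<^bsub>G Mod H\<^esub> \<longleftrightarrow> x \<in> H"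
  using coset_join1[of H x] coset_join2[of x H] subgroup_axioms subset by auto

text \<open>The map sends \<open>N #> x\<close> to \<open>M #> x\<close>. Its kernel consists of
  cosets of elements of \<open>M\<close> in \<open>S\<close>, and \<open>comm\<close> says that
  these commute with \<open>S\<close> modulo \<open>N\<close>.\<close>

lemma (in group) central_extension_quotients:
  assumes N: "N \<lhd> G" and M: "M \<lhd> G" and "N \<subseteq> M" and S: "subgroup S G"
    and comm: "\<And>g x. \<lbrakk>g \<in> M; g \<in> S; x \<in> S\<rbrakk> \<Longrightarrow> commutator G g x \<in> N"
  shows "\<exists>f. central_extension ((G Mod N)\<lparr>carrier := (\<lambda>x. N #> x) ` S\<rparr>)
    ((G Mod M)\<lparr>carrier := (\<lambda>x. M #> x) ` S\<rparr>) f"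
proof -
  let ?K = "G\<lparr>carrier := S\<rparr>"
  let ?A = "(G Mod N)\<lparr>carrier := (\<lambda>x. N #> x) ` S\<rparr>"
  let ?B = "(G Mod M)\<lparr>carrier := (\<lambda>x. M #> x) ` S\<rparr>"
  interpret S: subgroup S G by fact
  interpret N: normal N G by fact
  interpret M: normal M G by fact
  interpret n: group_hom ?K ?A "\<lambda>x. N #> x"
    by (rule group_hom.induced_group_hom[OF N.group_hom_r_coset S])
  interpret m: group_hom ?K ?B "\<lambda>x. M #> x"
    by (rule group_hom.induced_group_hom[OF M.group_hom_r_coset S])
  have n1: "N #> x = \<one>\<^bsub>?A\<^esub> \<longleftrightarrow> x \<in> N" if "x \<in> S" for x
    using N.r_coset_eq_one_iff[of x] that by simp
  have m1: "M #> x = \<one>\<^bsub>?B\<^esub> \<longleftrightarrow> x \<in> M" if "x \<in> S" for x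
    using M.r_coset_eq_one_iff[of x] that by simp
  obtain f where f: "f \<in> hom ?A ?B" "\<And>x. x \<in> S \<Longrightarrow> f (N #> x) = M #> x"
  proof (rule hom_factor[OF m.group_hom_axioms n.group_hom_axioms])
    show "(#>) N ` carrier ?K = carrier ?A" by simp
    show "M #> x = \<one>\<^bsub>?B\<^esub>" if "x \<in> carrier ?K" "N #> x = \<one>\<^bsub>?A\<^esub>" for x
      using that n1[of x] m1[of x] \<open>N \<subseteq> M\<close> by auto
  qed auto
  have "central_extension ?A ?B f"
  proof (intro central_extension.intro central_extension_axioms.intro
      group_hom.intro group_hom_axioms.intro n.H.is_group m.H.is_group f(1))
    show "f ` carrier ?A = carrier ?B"
      using f(2) by (auto simp: image_iff)
    fix z x assume z: "z \<in> kernel ?A ?B f" and x: "x \<in> carrier ?A"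
    obtain g where g: "g \<in> S" "z = N #> g" using z by (auto simp: kernel_def)
    obtain y where y: "y \<in> S" "x = N #> y" using x by auto
    have "M #> g = \<one>\<^bsub>?B\<^esub>" using z g f(2) by (simp add: kernel_def)
    then have "commutator G g y \<in> N" using comm g(1) y(1) m1 by blast
    moreover have "commutator G g y = (g \<otimes> y) \<otimes> inv (y \<otimes> g)"
      using g(1) y(1) by (simp add: commutator_def inv_mult_group m_assoc)
    ultimately have "N #> (g \<otimes> y) = N #> (y \<otimes> g)"
      using rcos_eq_iff[OF N.subgroup_axioms] g(1) y(1) by simp
    then show "z \<otimes>\<^bsub>?A\<^esub> x = x \<otimes>\<^bsub>?A\<^esub> z"
      using g y N.rcos_sum by simp
  qed
  then show ?thesis by (rule exI[of _ f])
qed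

text \<open>Rests on \<open>[gh,x] = g[h,x]g^-1 [g,x]\<close>,
  \<open>[g^-1,x] = g^-1[g,x]^-1 g\<close> and \<open>[ygy^-1,x] = y[g,y^-1xy]y^-1\<close>, together
  with normality of \<open>N\<close> and \<open>X\<close>.\<close>

lemma (in group) normal_commutator_preimage:
  assumes N: "N \<lhd> G" and X: "X \<lhd> G"
  shows "{g \<in> carrier G. \<forall>x\<in>X. commutator G g x \<in> N} \<lhd> G" (is "?C \<lhd> G")
proof -
  interpret N: normal N G by fact
  interpret X: normal X G by fact
  have mult: "commutator G (g \<otimes> h) x = (g \<otimes> commutator G h x \<otimes> inv g) \<otimes> commutator G g x"
    if "g \<in> carrier G" "h \<in> carrier G" "x \<in> carrier G" for g h x
  proof -
    have "(g \<otimes> commutator G h x \<otimes> inv g) \<otimes> commutator G g x =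
        g \<otimes> (h \<otimes> (x \<otimes> (inv h \<otimes> (((inv x \<otimes> (inv g \<otimes> g)) \<otimes> x) \<otimes> (inv g \<otimes> inv x)))))"
      using that unfolding commutator_def by (simp only: m_assoc m_closed inv_closed)
    also have "\<dots> = commutator G (g \<otimes> h) x"
      using that by (simp add: commutator_def inv_mult_group m_assoc)
    finally show ?thesis by simp
  qed
  have inv: "commutator G (inv g) x = inv g \<otimes> inv (commutator G g x) \<otimes> g"
    if "g \<in> carrier G" "x \<in> carrier G" for g x
    using that by (simp add: commutator_def inv_mult_group m_assoc)
  have conj: "commutator G (y \<otimes> g \<otimes> inv y) x = y \<otimes> commutator G g (inv y \<otimes> x \<otimes> y) \<otimes> inv y"
    if "g \<in> carrier G" "x \<in> carrier G" "y \<in> carrier G" for g x y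
  proof -
    have "y \<otimes> commutator G g (inv y \<otimes> x \<otimes> y) \<otimes> inv y =
        y \<otimes> (g \<otimes> (inv y \<otimes> (x \<otimes> ((y \<otimes> (inv g \<otimes> inv y)) \<otimes> (inv x \<otimes> (y \<otimes> inv y))))))"
      using that unfolding commutator_def
      by (simp only: m_assoc m_closed inv_closed inv_mult_group inv_inv)
    also have "\<dots> = commutator G (y \<otimes> g \<otimes> inv y) x"
      using that by (simp add: commutator_def inv_mult_group m_assoc)
    finally show ?thesis by simp
  qed
  have "subgroup ?C G"
  proof (rule subgroupI)
    show "?C \<subseteq> carrier G" by auto
    have "\<one> \<in> ?C" by (auto simp: commutator_def)
    then show "?C \<noteq> {}" by blast
    show "inv g \<in> ?C" if "g \<in> ?C" for g
      using that N.inv_op_closed1 by (auto simp: inv)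
    show "g \<otimes> h \<in> ?C" if "g \<in> ?C" "h \<in> ?C" for g h
      using that by (auto simp: mult intro!: N.inv_op_closed2)
  qed
  moreover have "y \<otimes> g \<otimes> inv y \<in> ?C" if y: "y \<in> carrier G" and g: "g \<in> ?C" for y g
  proof -
    have "inv y \<otimes> x \<otimes> y \<in> X" if "x \<in> X" for x using that y by (rule X.inv_op_closed1[rotated])
    then show ?thesis using y g by (auto simp: conj intro!: N.inv_op_closed2)
  qed
  ultimately show ?thesis by (simp add: normal_inv_iff)
qed

section \<open>The derived series and the tower of centres\<close>

lemma derived_series_1 [simp]: "derived_series H (Suc 0) = carrier H"
  by (simp add: derived_series_def)

text \<open>The recursion starts at index 1, since truncated subtraction makes the values at 0 and 1
  both the whole group.\<close>

lemma derived_series_Suc: "i \<ge> 1 \<Longrightarrow> derived_series H (Suc i) = derived H (derived_series H i)"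
  by (cases i) (simp_all add: derived_series_def)

lemma (in group) derived_series_normal: "derived_series G i \<lhd> G"
proof -
  have "(derived G ^^ k) (carrier G) \<lhd> G" for k
    by (induction k) (simp_all add: normal_self derived_is_normal)
  then show ?thesis by (simp add: derived_series_def)
qed

text \<open>\<open>centre_tower H n j\<close> consists of the \<open>g\<close> for which
  \<open>[\<dots>[[g, x\<^sub>i], x\<^sub>i\<^sub>+\<^sub>1], \<dots>, x\<^sub>n] = 1\<close> with \<open>i = n + 1 - j\<close>; unlike that of
  \<^const>\<open>derived_centre\<close>, this recursion strips the innermost commutator.\<close>

primrec centre_tower :: "('a, 'b) monoid_scheme \<Rightarrow> nat \<Rightarrow> nat \<Rightarrow> 'a set"
  where
    "centre_tower H n 0 = {\<one>\<^bsub>H\<^esub>}"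
  | "centre_tower H n (Suc j) =
      {g \<in> carrier H. \<forall>x\<in>derived_series H (n - j). commutator H g x \<in> centre_tower H n j}"

lemma (in group) centre_tower_normal: "centre_tower G n j \<lhd> G"
  by (induction j) (simp_all add: one_is_normal normal_commutator_preimage derived_series_normal)

text \<open>The commutator \<open>[g, x]\<close> is \<open>g\<close> times a conjugate of
  \<open>inv g\<close>, so it stays in any normal subgroup containing \<open>g\<close>.\<close>

lemma (in group) centre_tower_mono: "centre_tower G n j \<subseteq> centre_tower G n (Suc j)"
proof
  fix g assume g: "g \<in> centre_tower G n j"
  interpret E: normal "centre_tower G n j" G by (rule centre_tower_normal)
  have gG: "g \<in> carrier G" using g by (rule E.mem_carrier)
  have "commutator G g x \<in> centre_tower G n j" if "x \<in> derived_series G (n - j)" for x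
  proof -
    have x: "x \<in> carrier G"
      using subgroup.mem_carrier[OF normal_imp_subgroup[OF derived_series_normal] that] .
    have "g \<otimes> (x \<otimes> inv g \<otimes> inv x) \<in> centre_tower G n j"
      using g x by (intro E.m_closed E.inv_op_closed2 E.m_inv_closed)
    then show ?thesis using gG x by (simp add: commutator_def m_assoc)
  qed
  then show "g \<in> centre_tower G n (Suc j)" using gG by simp
qed

lemma left_commutator_cong:
  "(\<And>i. i \<in> {1..m} \<Longrightarrow> x i = y i) \<Longrightarrow> left_commutator H g x m = left_commutator H g y m"
  by (induction m) auto

lemma (in group) left_commutator_closed:
  assumes "g \<in> carrier G" and "\<And>i. i \<in> {1..m} \<Longrightarrow> x i \<in> carrier G"
  shows "left_commutator G g x m \<in> carrier G"
  using assms by (induction m) (auto simp: commutator_def)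

text \<open>Outer commutators are stripped one at a time: after removing \<open>j\<close> of them,
  the remaining commutator of length \<open>n - j\<close> lies in level \<open>j\<close> of the
  tower.\<close>

lemma (in group) derived_centre_subset: "derived_centre n G \<subseteq> centre_tower G n n"
proof
  fix g assume g: "g \<in> derived_centre n G"
  have *: "left_commutator G g x (n - j) \<in> centre_tower G n j"
    if "j \<le> n" "\<And>i. i \<in> {1..n - j} \<Longrightarrow> x i \<in> derived_series G i" for j x
    using that
  proof (induction j arbitrary: x)
    case 0
    then show ?case using g by (simp add: derived_centre_def)
  next
    case (Suc j)
    let ?m = "n - Suc j"
    have m: "n - j = Suc ?m" using Suc.prems(1) by simp
    have "x i \<in> carrier G" if "i \<in> {1..?m}" for i
      using subgroup.mem_carrier[OF normal_imp_subgroup[OF derived_series_normal]]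
        Suc.prems(2)[OF that] by blast
    then have "left_commutator G g x ?m \<in> carrier G"
      using g by (intro left_commutator_closed) (auto simp: derived_centre_def)
    moreover have "commutator G (left_commutator G g x ?m) y \<in> centre_tower G n j"
      if y: "y \<in> derived_series G (n - j)" for y
    proof -
      \<comment> \<open>Placing \<open>y\<close> at position \<open>n - j\<close> makes its
        commutator the outermost one and leaves the earlier entries alone.\<close>
      let ?x = "x(Suc ?m := y)"
      have "left_commutator G g ?x (n - j) \<in> centre_tower G n j"
      proof (rule Suc.IH)
        show "j \<le> n" using Suc.prems(1) by simp
        fix i assume i: "i \<in> {1..n - j}"
        show "?x i \<in> derived_series G i"
        proof (cases "i = Suc ?m")
          case True
          then show ?thesis using y m by simp
        next
          case False
          then have "i \<in> {1..?m}" using i m by auto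
          then show ?thesis using Suc.prems(2) False by simp
        qed
      qed
      moreover have "left_commutator G g ?x ?m = left_commutator G g x ?m"
        by (rule left_commutator_cong) auto
      ultimately show ?thesis unfolding m by simp
    qed
    ultimately show ?case by simp
  qed
  \<comment> \<open>At \<open>j = n\<close> the commutator has length 0 and is \<open>g\<close>; the
    constant sequence is a dummy.\<close>
  show "g \<in> centre_tower G n n"
    using *[of n "\<lambda>_. \<one>"] by simp
qed

section \<open>Descent and conclusion\<close>

text \<open>All quotients of \<open>H\<close> live on the type \<open>'b set\<close>, so one
  predicate \<open>P\<close> covers the whole descent. The return to the type of \<open>H\<close> is
  left as an epimorphism.\<close>

lemma derived_series_descent:
  fixes H :: "('b, 'y) monoid_scheme" and G :: "('c, 'z) monoid_scheme"
    and P :: "'b set monoid \<Rightarrow> bool"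
  assumes "group H" and "group G" and "\<pi> \<in> epi H G"
    and ker: "kernel H G \<pi> \<subseteq> derived_centre n H"
    and image: "\<And>A f. \<lbrakk>group A; f \<in> epi G A\<rbrakk> \<Longrightarrow> P A"
    and step: "\<And>A B f. \<lbrakk>central_extension A B f; P B\<rbrakk> \<Longrightarrow> P (A\<lparr>carrier := derived A (carrier A)\<rparr>)"
  shows "\<exists>A f. P A \<and> f \<in> epi A (H\<lparr>carrier := derived_series H (n + 1)\<rparr>)"
proof -
  interpret H: group H by fact
  let ?E = "centre_tower H n"
  define S where "S j = derived_series H (Suc n - j)" for j
  \<comment> \<open>The index \<open>j\<close> counts from the trivial end: \<open>?E j\<close> is
    the subgroup of the overview with index \<open>n + 1 - j\<close>. Thus \<open>A n\<close> is the
    quotient of \<open>H\<close> by \<open>?E n\<close>, and \<open>A 0\<close> is a copy of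
    \<open>derived_series H (n + 1)\<close>.\<close>
  define A where "A j = (H Mod ?E j)\<lparr>carrier := (\<lambda>x. ?E j #>\<^bsub>H\<^esub> x) ` S j\<rparr>" for j
  have S: "subgroup (S j) H" for j
    unfolding S_def by (rule normal_imp_subgroup[OF H.derived_series_normal])
  have E: "normal (?E j) H" for j by (rule H.centre_tower_normal)
  have hom: "group_hom H (H Mod ?E j) (\<lambda>x. ?E j #>\<^bsub>H\<^esub> x)" for j
    by (rule normal.group_hom_r_coset[OF E])
  \<comment> \<open>A downward induction from \<open>A n\<close>; by truncated subtraction it stays
    at \<open>A 0\<close> once \<open>k\<close> reaches \<open>n\<close>.\<close>
  have "P (A (n - k))" for k
  proof (induction k)
    case 0
    have \<pi>: "\<pi> \<in> hom H G" "\<pi> ` carrier H = carrier G"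
      using \<open>\<pi> \<in> epi H G\<close> by (auto simp: epi_def)
    have "group_hom H G \<pi>"
      by (intro group_hom.intro group_hom_axioms.intro \<open>group H\<close> \<open>group G\<close> \<pi>(1))
    then obtain f where f: "f \<in> hom G (H Mod ?E n)"
      "\<And>x. x \<in> carrier H \<Longrightarrow> f (\<pi> x) = ?E n #>\<^bsub>H\<^esub> x"
    proof (rule hom_factor[OF hom _ \<pi>(2)])
      fix x assume "x \<in> carrier H" "\<pi> x = \<one>\<^bsub>G\<^esub>"
      then have "x \<in> ?E n" using ker H.derived_centre_subset by (auto simp: kernel_def)
      then show "?E n #>\<^bsub>H\<^esub> x = \<one>\<^bsub>H Mod ?E n\<^esub>"
        using normal.r_coset_eq_one_iff[OF E] \<open>x \<in> carrier H\<close> by blast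
    qed auto
    have "f ` carrier G = (\<lambda>x. ?E n #>\<^bsub>H\<^esub> x) ` carrier H"
      using f(2) unfolding \<pi>(2)[symmetric] by (simp add: image_image)
    then have "f \<in> epi G (H Mod ?E n)" using f(1) by (simp add: epi_def carrier_FactGroup)
    moreover have "A n = H Mod ?E n"
      by (auto simp: A_def S_def FactGroup_def RCOSETS_def)
    ultimately show ?case
      using image normal.factorgroup_is_group[OF E] by simp
  next
    case (Suc k)
    show ?case
    proof (cases "k < n")
      case True
      define j where "j = n - Suc k"
      have j: "n - k = Suc j" "Suc n - j = Suc (n - j)" "n - j \<ge> 1" using True by (auto simp: j_def)
      let ?T = "derived_series H (n - j)"
      have Sj: "S (Suc j) = ?T" "S j = derived H ?T"
        using j derived_series_Suc[of "n - j" H] by (auto simp: S_def)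
      have T: "subgroup ?T H" using S[of "Suc j"] Sj(1) by simp
      \<comment> \<open>By the definition of the tower, \<open>?B\<close> is a central extension of
        \<open>A (Suc j)\<close>, and its derived subgroup is the carrier of
        \<open>A j\<close>.\<close>
      let ?B = "(H Mod ?E j)\<lparr>carrier := (\<lambda>x. ?E j #>\<^bsub>H\<^esub> x) ` ?T\<rparr>"
      obtain f where "central_extension ?B (A (Suc j)) f"
        using H.central_extension_quotients[OF E[of j] E[of "Suc j"] H.centre_tower_mono T]
        unfolding A_def Sj by auto
      then have "P (?B\<lparr>carrier := derived ?B (carrier ?B)\<rparr>)"
        using Suc.IH j(1) by (intro step) auto
      moreover have "derived ?B (carrier ?B) = (\<lambda>x. ?E j #>\<^bsub>H\<^esub> x) ` derived H ?T"
      proof -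
        have "subgroup ((\<lambda>x. ?E j #>\<^bsub>H\<^esub> x) ` ?T) (H Mod ?E j)"
          by (rule group_hom.subgroup_img_is_subgroup[OF hom T])
        then have "derived ?B (carrier ?B) = derived (H Mod ?E j) ((\<lambda>x. ?E j #>\<^bsub>H\<^esub> x) ` ?T)"
          using group.derived_consistent[OF normal.factorgroup_is_group[OF E]] by simp
        then show ?thesis
          using group_hom.derived_img[OF hom subgroup.subset[OF T]] by simp
      qed
      ultimately show ?thesis by (simp add: A_def Sj(2) flip: j_def)
    next
      case False
      then show ?thesis using Suc.IH by simp
    qed
  qed
  from this[of n] have "P (A 0)" by simp
  have r: "group_hom (H\<lparr>carrier := S 0\<rparr>) (A 0) (\<lambda>x. ?E 0 #>\<^bsub>H\<^esub> x)"
    unfolding A_def by (rule group_hom.induced_group_hom[OF hom S])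
  have q: "group_hom (H\<lparr>carrier := S 0\<rparr>) (H\<lparr>carrier := S 0\<rparr>) (\<lambda>x. x)"
    using H.subgroup_imp_group[OF S]
    by (intro group_hom.intro group_hom_axioms.intro) (auto simp: hom_def)
  \<comment> \<open>Factoring the identity through the quotient by the trivial group inverts the
    projection onto \<open>A 0\<close>.\<close>
  obtain f where f: "f \<in> hom (A 0) (H\<lparr>carrier := S 0\<rparr>)"
    "\<And>x. x \<in> S 0 \<Longrightarrow> f (?E 0 #>\<^bsub>H\<^esub> x) = x"
  proof (rule hom_factor[OF q r])
    show "(\<lambda>x. ?E 0 #>\<^bsub>H\<^esub> x) ` carrier (H\<lparr>carrier := S 0\<rparr>) = carrier (A 0)"
      by (simp add: A_def)
    show "x = \<one>\<^bsub>H\<lparr>carrier := S 0\<rparr>\<^esub>"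
      if "x \<in> carrier (H\<lparr>carrier := S 0\<rparr>)" "?E 0 #>\<^bsub>H\<^esub> x = \<one>\<^bsub>A 0\<^esub>" for x
      using that normal.r_coset_eq_one_iff[OF E[of 0], of x] subgroup.mem_carrier[OF S]
      by (simp add: A_def)
  qed auto
  have "f ` carrier (A 0) = S 0"
    using f(2) by (simp add: A_def image_image)
  then show ?thesis using f(1) \<open>P (A 0)\<close> by (auto simp: epi_def S_def)
qed

theorem proposition3p8:
  fixes N :: "('a, 'x) monoid_scheme"
    and H :: "('b, 'y) monoid_scheme"
    and G :: "('c, 'z) monoid_scheme"
    and \<iota> :: "'a \<Rightarrow> 'b" and \<pi> :: "'b \<Rightarrow> 'c" and n :: nat
  assumes "group_extension N H G \<iota> \<pi>"
    and "n \<ge> 1"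
    and "\<iota> ` carrier N \<subseteq> derived_centre n H"
  shows "(finite (carrier G) \<longrightarrow> finite (derived_series H (n + 1)))
    \<and> (\<forall>p::nat. Factorial_Ring.prime p \<longrightarrow> finite_p_group p G \<longrightarrow>
          finite_p_group p (H\<lparr>carrier := derived_series H (n + 1)\<rparr>))
    \<and> (perfect_group G \<longrightarrow> perfect_group (H\<lparr>carrier := derived_series H (n + 1)\<rparr>))
    \<and> (polycyclic G \<longrightarrow> polycyclic (H\<lparr>carrier := derived_series H (n + 1)\<rparr>))"
proof -
  have H: "group H" and G: "group G" and \<pi>: "\<pi> \<in> epi H G"
    and ker: "kernel H G \<pi> \<subseteq> derived_centre n H"
    using assms(1,3) unfolding group_extension_def by auto
  have \<Gamma>: "group (H\<lparr>carrier := derived_series H (n + 1)\<rparr>)"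
    using group.subgroup_imp_group[OF H normal_imp_subgroup[OF group.derived_series_normal[OF H]]] .
  \<comment> \<open>The descent gives each property for a group of cosets; closure under epimorphic
    images then moves it to the term of the derived series.\<close>
  note descent = derived_series_descent[OF H G \<pi> ker]
  show ?thesis
  proof (intro conjI allI impI)
    assume fin: "finite (carrier G)"
    have "\<exists>(A :: 'b set monoid) f. finite (carrier A) \<and> f \<in> epi A (H\<lparr>carrier := derived_series H (n + 1)\<rparr>)"
    proof (rule descent)
      show "finite (carrier A)" if "f \<in> epi G A" for A :: "'b set monoid" and f
        using fin that by (auto simp: epi_def dest: sym)
    qed (simp add: central_extension.finite_derived)
    then show "finite (derived_series H (n + 1))"
      by (auto simp: epi_def dest: sym)
  next
    fix p :: nat
    assume p: "Factorial_Ring.prime p" "finite_p_group p G"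
    have "\<exists>(A :: 'b set monoid) f. finite_p_group p A \<and> f \<in> epi A (H\<lparr>carrier := derived_series H (n + 1)\<rparr>)"
      by (rule descent)
         (use p finite_p_group_epi_image central_extension.finite_p_group_derived in blast)+
    then show "finite_p_group p (H\<lparr>carrier := derived_series H (n + 1)\<rparr>)"
      using finite_p_group_epi_image p(1) \<Gamma> by blast
  next
    assume "perfect_group G"
    then have "\<exists>(A :: 'b set monoid) f. perfect_group A \<and> f \<in> epi A (H\<lparr>carrier := derived_series H (n + 1)\<rparr>)"
      by (intro descent) (use perfect_epi_image central_extension.perfect_derived in blast)+
    then show "perfect_group (H\<lparr>carrier := derived_series H (n + 1)\<rparr>)"
      using perfect_epi_image \<Gamma> by blast
  next
    assume "polycyclic G"
    then have "\<exists>(A :: 'b set monoid) f. polycyclic A \<and> f \<in> epi A (H\<lparr>carrier := derived_series H (n + 1)\<rparr>)"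
      by (intro descent) (use polycyclic_epi_image central_extension.polycyclic_derived in blast)+
    then show "polycyclic (H\<lparr>carrier := derived_series H (n + 1)\<rparr>)"
      using polycyclic_epi_image \<Gamma> by blast
  qed
qed

end
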